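(* Let $\boldsymbol F=(f_1,\ldots,f_m)$ be a sequence of nonconstant polynomials in $R=K[x_1,\ldots,x_n]$, and put $d_i=\deg(f_i)$. (1) Assume that $m>n$, that $1\le d_{n+1}\le\cdots\le d_m$, and that $(f_1^{\rm top},\ldots,f_n^{\rm top})$ is a regular sequence. Then $$\mathrm{max.GB.deg}_{\prec^h}(F^h)\le d_1+\cdots+d_n+d_m-n.$$ If, in addition, $$\max\left\{d_m,\ d_{\rm reg}\bigl(\langle f_1^{\rm top},\ldots,f_{n+1}^{\rm top}\rangle\bigr)\right\}\le\left\lfloor\frac{d_1+\cdots+d_{n+1}-n-1}{2}\right\rfloor+1,$$ then $$\mathrm{max.GB.deg}_{\prec^h}(F^h)\le d_1+\cdots+d_n+d_{n+1}-n.$$ (2) Put $D=d_{\rm reg}(\langle F^{\rm top}\rangle)$, and let $s$ be the least positive integer such that $(\langle F^h\rangle:y^s)=(\langle F^h\rangle:y^\infty)$, where $(I:y^\infty):=\bigcup_{k\ge1}(I:y^k)$. Then $$\mathrm{max.GB.deg}_{\prec^h}(F^h)\le D+s-1.$$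
   Context: $K$ is a field, $R=K[x_1,\ldots,x_n]$, $R'=R[y]$ with an extra variable $y$. $\prec$ is a fixed degree reverse lexicographic (DRL) ordering on $R$, and $\prec^h$ is its homogenization on $R'$: for monomials $X_1,X_2$ of $R$, $X_1y^a\prec^h X_2y^b$ iff $\deg(X_1)+a<\deg(X_2)+b$, or these total degrees are equal and $X_1\prec X_2$; it is the DRL ordering on $R'$ with $y$ the smallest variable. For $f\in R\smallsetminus\{0\}$, $\deg(f)$ is the total degree, $f^{\rm top}$ is its homogeneous component of highest total degree, and $f^h\in R'$ is its homogenization with respect to $y$. Put $F=\{f_1,\ldots,f_m\}$, $F^{\rm top}=\{f_1^{\rm top},\ldots,f_m^{\rm top}\}\subset R$, $F^h=\{f_1^h,\ldots,f_m^h\}\subset R'$; $\langle\cdot\rangle$ is the generated ideal (of $R$ or $R'$ respectively). For a homogeneous ideal $I$ of a standard graded polynomial ring $S$, the degree of regularity $d_{\rm reg}(I)$ is the least integer $d\ge0$ with $I_d=S_d$, and $d_{\rm reg}(I)=\infty$ if there is none (a bound by $\infty$ is vacuous). $\mathrm{max.GB.deg}_{\prec^h}(F^h)$ is the maximum total degree of the elements of the reduced Gröbner basis of $\langle F^h\rangle$ with respect to $\prec^h$. *)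

theory Defs
  imports
    Complex_Main
    "HOL-Library.Poly_Mapping"
    "HOL-Library.Extended_Nat"
    "HOL-Library.Cardinality"
begin

text \<open>
  Multivariate polynomials are finitely supported maps from monomials (exponent vectors, written
  additively) to coefficients. For a finite type \<open>'x\<close> of variables, \<open>R\<close> is \<open>('x, 'k) mpoly\<close>, and
  \<open>R' = R[y]\<close> is \<open>('x option, 'k) mpoly\<close>, where \<open>None\<close> is the extra variable \<open>y\<close> and
  \<open>Some x\<close> is the old variable \<open>x\<close>.
\<close>

type_synonym 'v monom = "'v \<Rightarrow>\<^sub>0 nat"
type_synonym ('v, 'k) mpoly = "('v \<Rightarrow>\<^sub>0 nat) \<Rightarrow>\<^sub>0 'k"

subsection \<open>Degrees and homogeneous parts\<close>

definition mdeg :: "'v monom \<Rightarrow> nat" where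
  "mdeg t = (\<Sum>v\<in>Poly_Mapping.keys t. Poly_Mapping.lookup t v)"

text \<open>Total degree; the zero polynomial gets degree \<open>0\<close>.\<close>

definition tdeg :: "('v, 'k::zero) mpoly \<Rightarrow> nat" where
  "tdeg p = (if p = 0 then 0 else Max (mdeg ` Poly_Mapping.keys p))"

definition constant_poly :: "('v, 'k::zero) mpoly \<Rightarrow> bool" where
  "constant_poly p \<longleftrightarrow> (\<exists>c. p = Poly_Mapping.single 0 c)"

definition homogeneous :: "nat \<Rightarrow> ('v, 'k::zero) mpoly set" where
  "homogeneous d = {p. \<forall>t\<in>Poly_Mapping.keys p. mdeg t = d}"

definition hom_component :: "nat \<Rightarrow> ('v, 'k::comm_monoid_add) mpoly \<Rightarrow> ('v, 'k) mpoly" where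
  "hom_component d p =
     (\<Sum>t\<in>{t \<in> Poly_Mapping.keys p. mdeg t = d}.
        Poly_Mapping.single t (Poly_Mapping.lookup p t))"

definition top_part :: "('v, 'k::comm_monoid_add) mpoly \<Rightarrow> ('v, 'k) mpoly" where
  "top_part p = hom_component (tdeg p) p"

subsection \<open>Homogenization\<close>

text \<open>The monomial \<open>t * y ^ a\<close> of \<open>R'\<close>, for a monomial \<open>t\<close> of \<open>R\<close>.\<close>

definition ext_monom :: "'x monom \<Rightarrow> nat \<Rightarrow> 'x option monom" where
  "ext_monom t a =
     (\<Sum>x\<in>Poly_Mapping.keys t. Poly_Mapping.single (Some x) (Poly_Mapping.lookup t x))
     + Poly_Mapping.single None a"

definition homogenization ::
  "('x, 'k::comm_monoid_add) mpoly \<Rightarrow> ('x option, 'k) mpoly" where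
  "homogenization p =
     (\<Sum>t\<in>Poly_Mapping.keys p.
        Poly_Mapping.single (ext_monom t (tdeg p - mdeg t)) (Poly_Mapping.lookup p t))"

definition hom_var :: "('x option, 'k::zero_neq_one) mpoly" where
  "hom_var = Poly_Mapping.single (Poly_Mapping.single None 1) 1"

subsection \<open>Monomial orderings\<close>

text \<open>
  Strict degree reverse lexicographic ordering, with the variables ordered by the linear order
  on \<open>'v\<close>: for equal degrees, the monomial with the larger exponent at the smallest variable
  where the two differ is the smaller one.
\<close>

definition drl :: "('v::linorder) monom \<Rightarrow> 'v monom \<Rightarrow> bool" where
  "drl t u \<longleftrightarrow>
     mdeg t < mdeg u \<or>
     (mdeg t = mdeg u \<and>
      (\<exists>v. Poly_Mapping.lookup t v > Poly_Mapping.lookup u v \<and>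
           (\<forall>w<v. Poly_Mapping.lookup t w = Poly_Mapping.lookup u w)))"

text \<open>Every monomial of \<open>R'\<close> is uniquely of the form \<open>ext_monom t a\<close>.\<close>

definition homogenized_ord ::
  "('x monom \<Rightarrow> 'x monom \<Rightarrow> bool) \<Rightarrow> 'x option monom \<Rightarrow> 'x option monom \<Rightarrow> bool" where
  "homogenized_ord ord t' u' \<longleftrightarrow>
     (\<exists>t a u b. t' = ext_monom t a \<and> u' = ext_monom u b \<and>
        (mdeg t + a < mdeg u + b \<or> (mdeg t + a = mdeg u + b \<and> ord t u)))"

subsection \<open>Ideals\<close>

text \<open>The ideal generated by \<open>B\<close>: its span in the ring viewed as a module over itself.\<close>

definition ideal :: "'r::comm_ring_1 set \<Rightarrow> 'r set" where
  "ideal B = module.span (*) B"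

definition colon :: "'r::comm_ring_1 set \<Rightarrow> 'r \<Rightarrow> 'r set" where
  "colon I a = {g. g * a \<in> I}"

definition saturation :: "'r::comm_ring_1 set \<Rightarrow> 'r \<Rightarrow> 'r set" where
  "saturation I a = (\<Union>k\<in>{1..}. colon I (a ^ k))"

definition sat_index :: "'r::comm_ring_1 set \<Rightarrow> 'r \<Rightarrow> nat" where
  "sat_index I a = (LEAST s. 0 < s \<and> colon I (a ^ s) = saturation I a)"

text \<open>The sequence \<open>a 1, \<dots>, a r\<close> is regular.\<close>

definition regular_sequence :: "(nat \<Rightarrow> 'r::comm_ring_1) \<Rightarrow> nat \<Rightarrow> bool" where
  "regular_sequence a r \<longleftrightarrow>
     (\<forall>i\<in>{1..r}. \<forall>g. a i * g \<in> ideal (a ` {1..<i}) \<longrightarrow> g \<in> ideal (a ` {1..<i})) \<and>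
     ideal (a ` {1..r}) \<noteq> UNIV"

definition d_reg :: "('v, 'k::comm_ring_1) mpoly set \<Rightarrow> enat" where
  "d_reg I =
     (if \<exists>d. I \<inter> homogeneous d = homogeneous d
      then enat (LEAST d. I \<inter> homogeneous d = homogeneous d) else \<infinity>)"

subsection \<open>Groebner bases\<close>

text \<open>
  The argument \<open>ord\<close> below is a strict monomial ordering. The value of \<open>lead_monom\<close> is only
  meaningful for nonzero polynomials.
\<close>

definition lead_monom ::
  "('v monom \<Rightarrow> 'v monom \<Rightarrow> bool) \<Rightarrow> ('v, 'k::zero) mpoly \<Rightarrow> 'v monom" where
  "lead_monom ord p =
     (THE t. t \<in> Poly_Mapping.keys p \<and> (\<forall>u\<in>Poly_Mapping.keys p. u \<noteq> t \<longrightarrow> ord u t))"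

definition lead_ideal ::
  "('v monom \<Rightarrow> 'v monom \<Rightarrow> bool) \<Rightarrow> ('v, 'k::comm_ring_1) mpoly set \<Rightarrow> ('v, 'k) mpoly set" where
  "lead_ideal ord P = ideal ((\<lambda>p. Poly_Mapping.single (lead_monom ord p) 1) ` (P - {0}))"

definition groebner_basis ::
  "('v monom \<Rightarrow> 'v monom \<Rightarrow> bool) \<Rightarrow> ('v, 'k::comm_ring_1) mpoly set \<Rightarrow>
     ('v, 'k) mpoly set \<Rightarrow> bool" where
  "groebner_basis ord I G \<longleftrightarrow> finite G \<and> G \<subseteq> I \<and> lead_ideal ord G = lead_ideal ord I"

definition reduced_groebner_basis ::
  "('v monom \<Rightarrow> 'v monom \<Rightarrow> bool) \<Rightarrow> ('v, 'k::comm_ring_1) mpoly set \<Rightarrow>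
     ('v, 'k) mpoly set \<Rightarrow> bool" where
  "reduced_groebner_basis ord I G \<longleftrightarrow>
     groebner_basis ord I G \<and>
     (\<forall>g\<in>G. g \<noteq> 0 \<and> Poly_Mapping.lookup g (lead_monom ord g) = 1 \<and>
        (\<forall>t\<in>Poly_Mapping.keys g. Poly_Mapping.single t 1 \<notin> lead_ideal ord (G - {g})))"

text \<open>
  The maximal degree of the reduced Groebner basis of the ideal generated by \<open>P\<close>. The reduced
  Groebner basis of a nonzero ideal is nonempty, so \<open>Max\<close> is meaningful when \<open>P\<close> contains a
  nonzero polynomial.
\<close>

definition max_GB_deg ::
  "('v monom \<Rightarrow> 'v monom \<Rightarrow> bool) \<Rightarrow> ('v, 'k::comm_ring_1) mpoly set \<Rightarrow> nat" where
  "max_GB_deg ord P = Max (tdeg ` (THE G. reduced_groebner_basis ord (ideal P) G))"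

end

theory Submission
  imports Defs "HOL-Library.FuncSet" "HOL-Computational_Algebra.Formal_Power_Series"
begin

text \<open>
  Write \<open>I\<close> for the ideal of \<open>R' = R[y]\<close> generated by \<open>F\<^sup>h\<close>. Setting \<open>y = 0\<close> is a surjective ring
  homomorphism \<open>R' \<rightarrow> R\<close> with kernel \<open>y R'\<close> that maps \<open>f\<^sup>h\<close> to \<open>f\<^sup>t\<^sup>o\<^sup>p\<close>. One property of the ordering
  on \<open>R'\<close> links this map to Groebner bases: among monomials of equal total degree, a smaller exponent
  of \<open>y\<close> means a larger monomial. Hence a homogeneous polynomial is divisible by the power of \<open>y\<close> in
  its leading monomial. Moreover, if the ideal of the top parts contains all forms of degree \<open>D\<close>, then
  every monomial of degree at least \<open>D\<close> without \<open>y\<close> is a leading monomial of \<open>I\<close>. The elements of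
  the reduced Groebner basis correspond to the minimal leading monomials of \<open>I\<close> and have their
  degrees (\<open>max_GB_deg_le\<close>). Those without \<open>y\<close> have degree at most \<open>D\<close>, so the minimal leading
  monomials divisible by \<open>y\<close> remain to be bounded; their part in \<open>R\<close> has degree less than \<open>D\<close>.

  For the bound by the saturation index \<open>s\<close>, let \<open>u y\<^sup>a\<close> with \<open>a > s\<close> be a leading monomial of \<open>I\<close>. It
  belongs to some \<open>y\<^sup>a h \<in> I\<close>, so \<open>h\<close> lies in the saturation, \<open>y\<^sup>s h \<in> I\<close>, and \<open>u y\<^sup>a\<close> is not
  minimal. So \<open>a \<le> s\<close> for a minimal one, and its total degree is less than \<open>D + s\<close>.

  For the bounds by the degrees, a minimal leading monomial of degree above \<open>N\<close> divisible by \<open>y\<close>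
  is impossible as soon as multiplication by \<open>y\<close> on \<open>R'/I\<close> is injective in degrees at least
  \<open>N\<close> (\<open>min_lead_monom_mdeg_le\<close>). This injectivity is obtained in steps. Modulo the first \<open>n\<close>
  homogenizations \<open>y\<close> is a nonzerodivisor in all degrees, because their images under \<open>y = 0\<close> form a
  regular sequence (\<open>y_nonzerodivisor_if_regular\<close>). Adding generators of degree \<open>d\<close> preserves the
  injectivity in degrees at least \<open>N\<close> provided that \<open>D + d \<le> N + 1\<close>, where \<open>D\<close> is a degree in
  which the old ideal together with \<open>y R'\<close> contains all forms: in degree \<open>N + 1\<close> and above the
  coefficients of the new generators are then multiples of \<open>y\<close> modulo the old ideal, and \<open>y\<close> can be cancelled
  (\<open>y_injective_from_extend\<close>). With \<open>\<sigma> = (d\<^sub>1 - 1) + \<dots> + (d\<^sub>n - 1)\<close>, one such step with \<open>D = \<sigma> + 1\<close> and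
  \<open>N = \<sigma> + d\<^sub>m\<close> gives the first bound. The second bound takes two steps, both with
  \<open>N = \<sigma> + d\<^sub>n\<^sub>+\<^sub>1\<close>: first \<open>f\<^sub>n\<^sub>+\<^sub>1\<close> is added with \<open>D = \<sigma> + 1\<close>, then the others with the degree of
  regularity of the first \<open>n + 1\<close> top parts as \<open>D\<close>; the hypothesis bounds this \<open>D\<close> and \<open>d\<^sub>m\<close>
  by \<open>(N + 1) / 2\<close>, so that \<open>D + d\<^sub>m \<le> N + 1\<close>.

  That \<open>D = \<sigma> + 1\<close> is admissible is Macaulay's bound: \<open>n\<close> homogeneous polynomials in \<open>n\<close> variables
  that form a regular sequence generate all forms of degree above \<open>\<sigma>\<close>. The Hilbert series of the
  quotient is \<open>\<Prod> (1 - z\<^sup>d\<^sup>i) / (1 - z)\<^sup>n\<close>, a polynomial of degree \<open>\<sigma>\<close>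
  (\<open>homogeneous_subset_regular_ideal\<close>).
\<close>

section \<open>Ideals\<close>

text \<open>
  The interpretation is kept local because its simplification rules reassociate products to the left,
  against the usual normalization of ring expressions.
\<close>

context
begin

interpretation ring_module: module "(*) :: 'r::comm_ring_1 \<Rightarrow> 'r \<Rightarrow> 'r"
  by unfold_locales (auto simp: algebra_simps)

lemma ideal_zero [simp]: "0 \<in> ideal B"
  by (simp add: ideal_def ring_module.span_zero)

lemma ideal_base: "b \<in> B \<Longrightarrow> b \<in> ideal B"
  by (simp add: ideal_def ring_module.span_base)

lemma ideal_add: "p \<in> ideal B \<Longrightarrow> q \<in> ideal B \<Longrightarrow> p + q \<in> ideal B"
  by (simp add: ideal_def ring_module.span_add)

lemma ideal_diff: "p \<in> ideal B \<Longrightarrow> q \<in> ideal B \<Longrightarrow> p - q \<in> ideal B"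
  by (simp add: ideal_def ring_module.span_diff)

lemma ideal_mult: "p \<in> ideal B \<Longrightarrow> q * p \<in> ideal B"
  by (simp add: ideal_def ring_module.span_scale)

lemma ideal_mult_right: "p \<in> ideal B \<Longrightarrow> p * q \<in> ideal B"
  using ideal_mult[of p B q] by (simp add: mult.commute)

lemma ideal_sum: "(\<And>x. x \<in> A \<Longrightarrow> f x \<in> ideal B) \<Longrightarrow> sum f A \<in> ideal B"
  by (simp add: ideal_def ring_module.span_sum)

lemma ideal_diff_cancel: "p - q \<in> ideal B \<Longrightarrow> q \<in> ideal B \<Longrightarrow> p \<in> ideal B"
  using ideal_add[of "p - q" B q] by simp

lemma ideal_mono: "A \<subseteq> B \<Longrightarrow> ideal A \<subseteq> ideal B"
  by (simp add: ideal_def ring_module.span_mono)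

lemma ideal_subsetI: "A \<subseteq> ideal B \<Longrightarrow> ideal A \<subseteq> ideal B"
  by (simp add: ideal_def ring_module.span_minimal)

lemma ideal_empty [simp]: "ideal {} = {0}"
  by (simp add: ideal_def)

lemma ideal_induct [consumes 1, case_names zero step]:
  assumes "p \<in> ideal B" "P 0" "\<And>c b q. b \<in> B \<Longrightarrow> q \<in> ideal B \<Longrightarrow> P q \<Longrightarrow> P (c * b + q)"
  shows "P p"
proof -
  have "p \<in> ideal B \<and> P p"
    using assms(1) unfolding ideal_def
  proof (induction rule: ring_module.span_induct_alt)
    case base
    show ?case using assms(2) by (simp add: ring_module.span_zero)
  next
    case (step c b q)
    then show ?case using assms(3)[of b q c]
      by (simp add: ideal_def ring_module.span_add ring_module.span_scale ring_module.span_base)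
  qed
  then show ?thesis ..
qed

lemma ideal_insert: "p \<in> ideal (insert a B) \<longleftrightarrow> (\<exists>c. p - c * a \<in> ideal B)"
  by (simp add: ideal_def ring_module.span_breakdown_eq)

lemma ideal_Un: "p \<in> ideal (A \<union> B) \<longleftrightarrow> (\<exists>a\<in>ideal A. \<exists>b\<in>ideal B. p = a + b)"
  by (auto simp: ideal_def ring_module.span_Un)

end

text \<open>
  Surjectivity lifts the coefficients of a combination of \<open>h ` B\<close>; this gives the inclusion from right
  to left.
\<close>

lemma ideal_ring_hom_image:
  fixes h :: "'r::comm_ring_1 \<Rightarrow> 's::comm_ring_1"
  assumes "\<And>p q. h (p + q) = h p + h q" "\<And>p q. h (p * q) = h p * h q" "surj h"
  shows "h ` ideal B = ideal (h ` B)"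
proof
  have h0: "h 0 = 0" using assms(1)[of 0 0] by simp
  have "h p \<in> ideal (h ` B)" if "p \<in> ideal B" for p
    using that by (induction rule: ideal_induct) (auto simp: h0 assms intro: ideal_add ideal_mult ideal_base)
  then show "h ` ideal B \<subseteq> ideal (h ` B)" by blast
  have "q \<in> h ` ideal B" if "q \<in> ideal (h ` B)" for q
    using that
  proof (induction rule: ideal_induct)
    case zero
    show ?case using h0 by (metis ideal_zero imageI)
  next
    case (step c b q)
    obtain c' b' q' where "c = h c'" "b = h b'" "b' \<in> B" "q = h q'" "q' \<in> ideal B"
      using step assms(3) by (metis imageE surjE)
    then have "c * b + q = h (c' * b' + q')" "c' * b' + q' \<in> ideal B"
      by (auto simp: assms intro: ideal_add ideal_mult ideal_base)
    then show ?case by blast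
  qed
  then show "ideal (h ` B) \<subseteq> h ` ideal B" by blast
qed

section \<open>Monomials\<close>

abbreviation keys :: "('a \<Rightarrow>\<^sub>0 'b::zero) \<Rightarrow> 'a set" where "keys \<equiv> Poly_Mapping.keys"
abbreviation lookup :: "('a \<Rightarrow>\<^sub>0 'b::zero) \<Rightarrow> 'a \<Rightarrow> 'b" where "lookup \<equiv> Poly_Mapping.lookup"
abbreviation single :: "'a \<Rightarrow> 'b \<Rightarrow> ('a \<Rightarrow>\<^sub>0 'b::zero)" where "single \<equiv> Poly_Mapping.single"

lemma mdeg_superset: "finite A \<Longrightarrow> keys t \<subseteq> A \<Longrightarrow> mdeg t = (\<Sum>v\<in>A. lookup t v)"
  unfolding mdeg_def by (rule sum.mono_neutral_left) (auto simp: in_keys_iff)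

lemma mdeg_zero [simp]: "mdeg 0 = 0"
  by (simp add: mdeg_def)

lemma mdeg_add [simp]: "mdeg (s + t) = mdeg s + mdeg t"
proof -
  have fin: "finite (keys s \<union> keys t)" by simp
  have "mdeg (s + t) = (\<Sum>v\<in>keys s \<union> keys t. lookup (s + t) v)"
    by (rule mdeg_superset[OF fin keys_add])
  also have "\<dots> = mdeg s + mdeg t"
    using mdeg_superset[OF fin, of s] mdeg_superset[OF fin, of t]
    by (simp add: lookup_add sum.distrib)
  finally show ?thesis .
qed

lemma mdeg_sum: "mdeg (sum f A) = (\<Sum>x\<in>A. mdeg (f x))"
  by (induction A rule: infinite_finite_induct) auto

lemma mdeg_single [simp]: "mdeg (single v a) = a"
  by (simp add: mdeg_def)

lemma lookup_le_mdeg: "lookup t v \<le> mdeg t"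
proof (cases "v \<in> keys t")
  case True
  then show ?thesis unfolding mdeg_def by (intro member_le_sum) auto
qed (simp add: in_keys_iff)

lemma mdeg_eq_0_iff [simp]: "mdeg t = 0 \<longleftrightarrow> t = 0"
proof
  assume "mdeg t = 0"
  then have "lookup t v = 0" for v using lookup_le_mdeg[of t v] by simp
  then show "t = 0" by (simp add: poly_mapping_eqI)
qed simp

lemma finite_monoms_mdeg_le: "finite {t :: 'v::finite monom. mdeg t \<le> N}"
proof (rule finite_imageD)
  have "lookup ` {t :: 'v monom. mdeg t \<le> N} \<subseteq> (UNIV \<rightarrow>\<^sub>E {..N})"
    using lookup_le_mdeg order_trans by fastforce
  moreover have "finite ((UNIV :: 'v set) \<rightarrow>\<^sub>E {..N})" by (intro finite_PiE) auto
  ultimately show "finite (lookup ` {t :: 'v monom. mdeg t \<le> N})" by (rule finite_subset)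
  show "inj_on lookup {t :: 'v monom. mdeg t \<le> N}" by (simp add: inj_on_def)
qed

lemma finite_monoms_mdeg_eq: "finite {t :: 'v::finite monom. mdeg t = N}"
  by (rule finite_subset[OF _ finite_monoms_mdeg_le[of N]]) auto

lemma monom_split_var:
  assumes "v \<in> keys (t :: 'v monom)"
  obtains s where "t = s + single v 1"
proof
  show "t = (t - single v 1) + single v 1"
    using assms by (intro poly_mapping_eqI) (auto simp: lookup_add lookup_minus lookup_single when_def in_keys_iff)
qed

lemma monom_submonom:
  assumes "d \<le> mdeg (t :: 'v monom)"
  obtains s w where "t = s + w" "mdeg s = d"
proof -
  have "\<exists>s w. t = s + w \<and> mdeg s = d"
    using assms
  proof (induction "mdeg t - d" arbitrary: t)
    case 0
    then show ?case by (intro exI[of _ t] exI[of _ 0]) auto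
  next
    case (Suc k)
    then have "mdeg t \<noteq> 0" by auto
    then obtain v where "v \<in> keys t" by (metis mdeg_eq_0_iff all_not_in_conv keys_eq_empty)
    then obtain u where u: "t = u + single v 1" by (rule monom_split_var)
    then have "k = mdeg u - d" "d \<le> mdeg u" using Suc.hyps(2) by auto
    from Suc.hyps(1)[OF this] obtain s w where "u = s + w" "mdeg s = d" by blast
    then show ?case using u by (metis add.assoc)
  qed
  then show ?thesis using that by blast
qed

section \<open>Polynomials and their homogeneous components\<close>

lemma sum_single_keys: "(\<Sum>t\<in>keys p. single t (lookup p t)) = p"
  by (rule poly_mapping_eqI) (auto simp: lookup_sum lookup_single when_def in_keys_iff)

lemma poly_induct [case_names zero single add]:
  fixes p :: "'a \<Rightarrow>\<^sub>0 'b::comm_monoid_add"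
  assumes "P 0" "\<And>t c. P (single t c)" "\<And>p q. P p \<Longrightarrow> P q \<Longrightarrow> P (p + q)"
  shows "P p"
proof -
  have "P (\<Sum>t\<in>A. single t (lookup p t))" if "finite A" for A
    using that by (induction rule: finite_induct) (auto intro: assms)
  from this[of "keys p"] show ?thesis by (simp add: sum_single_keys)
qed

lemma lookup_single_mult:
  fixes p :: "('v, 'k::comm_ring_1) mpoly"
  shows "lookup (single s c * p) (s + t) = c * lookup p t"
  by (induction p rule: poly_induct)
     (auto simp: mult_single lookup_single when_def distrib_left lookup_add)

lemma keys_single_mult:
  fixes p :: "('v, 'k::field) mpoly"
  assumes "c \<noteq> 0"
  shows "keys (single s c * p) = (+) s ` keys p"
proof
  show "keys (single s c * p) \<subseteq> (+) s ` keys p"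
    using keys_mult[of "single s c" p] assms by auto
  show "(+) s ` keys p \<subseteq> keys (single s c * p)"
    using assms by (auto simp: in_keys_iff lookup_single_mult)
qed

lemma single_mult_eq_0_iff:
  fixes p :: "('v, 'k::field) mpoly"
  shows "c \<noteq> 0 \<Longrightarrow> single s c * p = 0 \<longleftrightarrow> p = 0"
  by (metis keys_single_mult image_is_empty keys_eq_empty)

lemma poly_scale_lookup:
  fixes p :: "('v, 'k::comm_ring_1) mpoly"
  shows "lookup (single 0 c * p) t = c * lookup p t"
  using lookup_single_mult[of 0 c p t] by simp

lemma lookup_hom_component: "lookup (hom_component d p) t = (if mdeg t = d then lookup p t else 0)"
  by (auto simp: hom_component_def lookup_sum lookup_single when_def in_keys_iff)

lemma keys_hom_component: "keys (hom_component d p) = {t\<in>keys p. mdeg t = d}"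
  by (auto simp: in_keys_iff lookup_hom_component split: if_splits)

lemma homogeneousD: "p \<in> homogeneous d \<Longrightarrow> t \<in> keys p \<Longrightarrow> mdeg t = d"
  by (simp add: homogeneous_def)

lemma hom_component_homogeneous [simp]: "hom_component d p \<in> homogeneous d"
  by (simp add: homogeneous_def keys_hom_component)

lemma hom_component_same: "p \<in> homogeneous d \<Longrightarrow> hom_component d p = p"
  by (rule poly_mapping_eqI) (auto simp: homogeneous_def lookup_hom_component in_keys_iff)

lemma hom_component_other: "p \<in> homogeneous d \<Longrightarrow> e \<noteq> d \<Longrightarrow> hom_component e p = 0"
  by (rule poly_mapping_eqI) (auto simp: homogeneous_def lookup_hom_component in_keys_iff)

lemma hom_component_zero [simp]: "hom_component d 0 = 0"
  by (simp add: hom_component_def)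

lemma hom_component_add: "hom_component d (p + q) = hom_component d p + hom_component d q"
  by (rule poly_mapping_eqI) (simp add: lookup_hom_component lookup_add)

lemma hom_component_diff:
  fixes p q :: "('v, 'k::ab_group_add) mpoly"
  shows "hom_component d (p - q) = hom_component d p - hom_component d q"
  by (rule poly_mapping_eqI) (simp add: lookup_hom_component lookup_minus)

lemma homogeneous_zero [simp]: "0 \<in> homogeneous d"
  by (simp add: homogeneous_def)

lemma homogeneous_add: "p \<in> homogeneous d \<Longrightarrow> q \<in> homogeneous d \<Longrightarrow> p + q \<in> homogeneous d"
  using keys_add[of p q] by (auto simp: homogeneous_def)

lemma homogeneous_single: "mdeg t = d \<Longrightarrow> single t c \<in> homogeneous d"
  by (simp add: homogeneous_def)

lemma homogeneous_mult:
  fixes p q :: "('v, 'k::comm_ring_1) mpoly"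
  shows "p \<in> homogeneous d \<Longrightarrow> q \<in> homogeneous e \<Longrightarrow> p * q \<in> homogeneous (d + e)"
  using keys_mult[of p q] by (fastforce simp: homogeneous_def)

lemma hom_component_mult:
  fixes g q :: "('v, 'k::comm_ring_1) mpoly"
  assumes g: "g \<in> homogeneous d"
  shows "hom_component e (g * q) = (if d \<le> e then g * hom_component (e - d) q else 0)"
proof (induction q rule: poly_induct)
  case (single t c)
  have s: "single t c \<in> homogeneous (mdeg t)" by (simp add: homogeneous_single)
  note gs = homogeneous_mult[OF g s]
  show ?case
  proof (cases "e = d + mdeg t")
    case True
    then show ?thesis using gs s by (simp add: hom_component_same)
  next
    case False
    then show ?thesis using hom_component_other[OF gs False] hom_component_other[OF s, of "e - d"] by auto
  qed
qed (auto simp: distrib_left hom_component_add)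

lemma keys_subset_tdeg: "t \<in> keys p \<Longrightarrow> mdeg t \<le> tdeg p"
  by (auto simp: tdeg_def)

lemma sum_hom_component: "(\<Sum>e\<le>tdeg p. hom_component e p) = p"
proof (rule poly_mapping_eqI)
  fix t
  have "lookup (\<Sum>e\<le>tdeg p. hom_component e p) t = (if mdeg t \<le> tdeg p then lookup p t else 0)"
    by (simp add: lookup_sum lookup_hom_component)
  also have "\<dots> = lookup p t" using keys_subset_tdeg[of t p] by (auto simp: in_keys_iff)
  finally show "lookup (\<Sum>e\<le>tdeg p. hom_component e p) t = lookup p t" .
qed

text \<open>
  A homogeneous generator \<open>b\<close> of degree \<open>d\<close> only shifts degrees: the component of \<open>c * b\<close> in degree \<open>e\<close>
  is \<open>b\<close> times the component of \<open>c\<close> in degree \<open>e - d\<close>. So the generated ideal is graded.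
\<close>

lemma ideal_hom_component:
  fixes B :: "('v, 'k::comm_ring_1) mpoly set"
  assumes B: "\<And>b. b \<in> B \<Longrightarrow> \<exists>d. b \<in> homogeneous d" and p: "p \<in> ideal B"
  shows "hom_component e p \<in> ideal B"
  using p
proof (induction rule: ideal_induct)
  case (step c b q)
  obtain d where "b \<in> homogeneous d" using B step(1) by blast
  then have "hom_component e (b * c) \<in> ideal B"
    using step(1) by (auto simp: hom_component_mult intro: ideal_mult_right ideal_base)
  then show ?case using step by (auto simp: hom_component_add mult.commute intro: ideal_add)
qed simp

section \<open>Monomial ideals\<close>

text \<open>
  Every monomial that occurs in an element of a monomial ideal is divisible by one of its generators,
  so questions about leading ideals become questions about divisibility of monomials.
\<close>

lemma single_in_monomial_ideal_iff:
  "single t (1::'k::comm_ring_1) \<in> ideal ((\<lambda>s. single s 1) ` S) \<longleftrightarrow> (\<exists>s\<in>S. \<exists>w. t = s + w)"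
proof
  have "\<forall>t\<in>keys p. \<exists>s\<in>S. \<exists>w. t = s + w" if "p \<in> ideal ((\<lambda>s. single s (1::'k)) ` S)" for p
    using that
  proof (induction rule: ideal_induct)
    case (step c b q)
    then obtain s where s: "s \<in> S" "b = single s 1" by blast
    have "keys (c * b + q) \<subseteq> keys (b * c) \<union> keys q"
      using keys_add[of "c * b" q] by (simp add: mult.commute)
    moreover have "\<exists>s\<in>S. \<exists>w. t = s + w" if "t \<in> keys (b * c)" for t
      using that keys_mult[of b c] s by fastforce
    ultimately show ?case using step(3) by blast
  qed simp
  then show "single t (1::'k) \<in> ideal ((\<lambda>s. single s 1) ` S) \<Longrightarrow> \<exists>s\<in>S. \<exists>w. t = s + w"
    by force
next
  assume "\<exists>s\<in>S. \<exists>w. t = s + w"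
  then obtain s w where "s \<in> S" "t = s + w" by blast
  then show "single t (1::'k) \<in> ideal ((\<lambda>s. single s 1) ` S)"
    using ideal_mult[OF ideal_base, of "single s 1" _ "single w (1::'k)"]
    by (auto simp: mult_single add.commute)
qed

section \<open>Degree-compatible monomial orderings\<close>

text \<open>
  Compatibility with the degree makes the ordering well-founded without Dickson's lemma, since only
  finitely many monomials lie below a given one. It also makes the degree of a polynomial the
  degree of its leading monomial.
\<close>

locale graded_monomial_order =
  fixes ord :: "'v::finite monom \<Rightarrow> 'v monom \<Rightarrow> bool"
  assumes irrefl: "\<not> ord t t"
    and trans: "ord s t \<Longrightarrow> ord t u \<Longrightarrow> ord s u"
    and total: "s \<noteq> t \<Longrightarrow> ord s t \<or> ord t s"
    and plus_mono: "ord s t \<Longrightarrow> ord (u + s) (u + t)"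
    and mdeg_less: "mdeg s < mdeg t \<Longrightarrow> ord s t"
begin

lemma asym: "ord s t \<Longrightarrow> \<not> ord t s"
  using irrefl trans by blast

lemma mdeg_mono: "ord s t \<Longrightarrow> mdeg s \<le> mdeg t"
  using asym mdeg_less not_le by blast

lemma wf: "wf {(s, t). ord s t}"
proof (rule wf_subset[OF wf_measure[of "\<lambda>t. card {s. ord s t}"]])
  have fin: "finite {s. ord s t}" for t
    by (rule finite_subset[OF _ finite_monoms_mdeg_le[of "mdeg t"]]) (auto dest: mdeg_mono)
  have "card {u. ord u s} < card {u. ord u t}" if "ord s t" for s t
    by (rule psubset_card_mono[OF fin]) (use that trans irrefl in blast)
  then show "{(s, t). ord s t} \<subseteq> measure (\<lambda>t. card {s. ord s t})" by auto
qed

lemma finite_has_greatest: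
  "finite A \<Longrightarrow> A \<noteq> {} \<Longrightarrow> \<exists>t\<in>A. \<forall>u\<in>A. u \<noteq> t \<longrightarrow> ord u t"
proof (induction rule: finite_ne_induct)
  case (insert x A)
  then obtain t where t: "t \<in> A" "\<forall>u\<in>A. u \<noteq> t \<longrightarrow> ord u t" by blast
  show ?case
  proof (cases "ord x t")
    case True
    then show ?thesis using t by auto
  next
    case False
    then have "ord t x" using total[of x t] t insert by blast
    then show ?thesis using t trans by (metis insert_iff)
  qed
qed simp

abbreviation lm :: "('v, 'k::zero) mpoly \<Rightarrow> 'v monom" where "lm \<equiv> lead_monom ord"

lemma lmI:
  assumes "t \<in> keys p" "\<And>u. u \<in> keys p \<Longrightarrow> u \<noteq> t \<Longrightarrow> ord u t"
  shows "lm p = t"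
  unfolding lead_monom_def
proof (rule the_equality)
  fix s assume s: "s \<in> keys p \<and> (\<forall>u\<in>keys p. u \<noteq> s \<longrightarrow> ord u s)"
  show "s = t"
  proof (rule ccontr)
    assume "s \<noteq> t"
    then have "ord s t" "ord t s" using s assms by auto
    then show False using asym by blast
  qed
qed (use assms in auto)

lemma lm_props:
  assumes "p \<noteq> 0"
  shows lm_in_keys: "lm p \<in> keys p" and lm_greatest: "u \<in> keys p \<Longrightarrow> u \<noteq> lm p \<Longrightarrow> ord u (lm p)"
proof -
  have "keys p \<noteq> {}" using assms by simp
  from finite_has_greatest[OF finite_keys this]
  obtain t where t: "t \<in> keys p" "\<forall>u\<in>keys p. u \<noteq> t \<longrightarrow> ord u t" by blast
  then have "lm p = t" by (intro lmI) auto
  then show "lm p \<in> keys p" "u \<in> keys p \<Longrightarrow> u \<noteq> lm p \<Longrightarrow> ord u (lm p)" using t by auto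
qed

lemma lm_single_mult:
  fixes p :: "('v, 'k::field) mpoly"
  assumes "c \<noteq> 0" "p \<noteq> 0"
  shows "lm (single s c * p) = s + lm p"
  by (rule lmI) (use assms lm_props[of p] plus_mono in \<open>auto simp: keys_single_mult\<close>)

lemma tdeg_eq_mdeg_lm: "p \<noteq> 0 \<Longrightarrow> tdeg p = mdeg (lm p)"
  unfolding tdeg_def using lm_props[of p] mdeg_mono
  by (auto intro!: Max_eqI)

lemma lm_hom_component:
  assumes "p \<noteq> 0"
  shows "hom_component (mdeg (lm p)) p \<noteq> 0" "lm (hom_component (mdeg (lm p)) p) = lm p"
proof -
  have k: "lm p \<in> keys (hom_component (mdeg (lm p)) p)"
    using lm_in_keys[OF assms] by (simp add: keys_hom_component)
  then show "hom_component (mdeg (lm p)) p \<noteq> 0" by force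
  show "lm (hom_component (mdeg (lm p)) p) = lm p"
    by (rule lmI[OF k]) (use lm_greatest[OF assms] in \<open>auto simp: keys_hom_component\<close>)
qed

section \<open>Leading monomials and normal forms\<close>

definition lead_monoms :: "('v, 'k::zero) mpoly set \<Rightarrow> 'v monom set" where
  "lead_monoms P = lm ` (P - {0})"

text \<open>
  The minimal generators of the leading ideal, that is the leading monomials of the elements of the
  reduced Groebner basis when \<open>P\<close> is an ideal.
\<close>

definition min_lead_monoms :: "('v, 'k::zero) mpoly set \<Rightarrow> 'v monom set" where
  "min_lead_monoms P =
     {t \<in> lead_monoms P. \<forall>s w. t = s + w \<longrightarrow> s \<in> lead_monoms P \<longrightarrow> w = 0}"

lemma single_in_lead_ideal_iff:
  fixes P :: "('v, 'k::comm_ring_1) mpoly set"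
  shows "single t 1 \<in> lead_ideal ord P \<longleftrightarrow> (\<exists>s\<in>lead_monoms P. \<exists>w. t = s + w)"
proof -
  have "lead_ideal ord P = ideal ((\<lambda>s. single s 1) ` lead_monoms P)"
    by (simp add: lead_ideal_def lead_monoms_def image_image)
  then show ?thesis by (simp add: single_in_monomial_ideal_iff)
qed

lemma lead_monoms_plus:
  fixes B :: "('v, 'k::field) mpoly set"
  assumes "s \<in> lead_monoms (ideal B)"
  shows "s + w \<in> lead_monoms (ideal B)"
proof -
  obtain p where p: "p \<in> ideal B" "p \<noteq> 0" "s = lm p" using assms by (auto simp: lead_monoms_def)
  then have "single w 1 * p \<in> ideal B - {0}" "lm (single w 1 * p) = s + w"
    by (auto simp: single_mult_eq_0_iff lm_single_mult add.commute intro: ideal_mult)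
  then show ?thesis unfolding lead_monoms_def by force
qed

lemma min_lead_monom_exists:
  assumes "t \<in> lead_monoms P"
  shows "\<exists>s\<in>min_lead_monoms P. \<exists>w. t = s + w"
  using assms
proof (induction "mdeg t" arbitrary: t rule: less_induct)
  case less
  show ?case
  proof (cases "t \<in> min_lead_monoms P")
    case True
    then show ?thesis by (metis add_0_right)
  next
    case False
    then obtain s w where sw: "t = s + w" "s \<in> lead_monoms P" "w \<noteq> 0"
      using less(2) by (auto simp: min_lead_monoms_def)
    then have "mdeg s < mdeg t" using mdeg_eq_0_iff[of w] by (simp del: mdeg_eq_0_iff)
    from less(1)[OF this sw(2)] show ?thesis using sw(1) by (metis add.assoc)
  qed
qed

lemma eq_zero_if_standard:
  assumes "p \<in> P" "keys p \<inter> lead_monoms P = {}"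
  shows "p = 0"
proof (rule ccontr)
  assume "p \<noteq> 0"
  then have "lm p \<in> keys p \<inter> lead_monoms P" using lm_in_keys assms(1) by (auto simp: lead_monoms_def)
  then show False using assms(2) by blast
qed

lemma lm_tail:
  assumes "u \<in> keys (p - single (lm p) (lookup p (lm p)))"
  shows "u \<in> keys p" "u \<noteq> lm p"
  using assms by (auto simp: in_keys_iff lookup_minus lookup_single when_def split: if_splits)

text \<open>
  Reduction of \<open>p\<close> modulo the ideal. The largest monomial of \<open>p\<close> is either cancelled by an element of
  the ideal with the same leading monomial, or it is moved to the remainder; in both cases what is
  left lies below that monomial. The bound \<open>t\<close> is the induction parameter, and it keeps the tail of a
  reduced basis element below its leading monomial.
\<close>

lemma normal_form_below:
  fixes p :: "('v, 'k::field) mpoly"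
  assumes "\<forall>u\<in>keys p. ord u t"
  shows "\<exists>r. p - r \<in> ideal B \<and> keys r \<inter> lead_monoms (ideal B) = {} \<and> (\<forall>u\<in>keys r. ord u t)"
  using assms
proof (induction t arbitrary: p rule: wf_induct_rule[OF wf])
  case (1 t)
  show ?case
  proof (cases "p = 0")
    case True
    then show ?thesis by (intro exI[of _ 0]) auto
  next
    case False
    define s where "s = lm p"
    define c where "c = lookup p s"
    have st: "ord s t" using 1(2) lm_in_keys[OF False] s_def by blast
    have c0: "c \<noteq> 0" using lm_in_keys[OF False] by (simp add: c_def s_def in_keys_iff)
    show ?thesis
    proof (cases "s \<in> lead_monoms (ideal B)")
      case True
      then obtain g where g: "g \<in> ideal B" "g \<noteq> 0" "s = lm g" by (auto simp: lead_monoms_def)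
      define b where "b = lookup g s"
      have b0: "b \<noteq> 0" using lm_in_keys[OF g(2)] g(3) by (simp add: b_def in_keys_iff)
      define q where "q = single 0 (c / b) * g"
      have q: "q \<in> ideal B" by (simp add: q_def ideal_mult g)
      have "ord u s" if "u \<in> keys (p - q)" for u
      proof -
        have "lookup (p - q) s = 0" using b0 by (simp add: q_def lookup_minus poly_scale_lookup c_def b_def)
        then have us: "u \<noteq> s" using that by auto
        have "lookup p u \<noteq> 0 \<or> lookup g u \<noteq> 0"
          using that by (auto simp: in_keys_iff lookup_minus q_def poly_scale_lookup)
        then show ?thesis
          using us lm_greatest[OF False, of u] lm_greatest[OF g(2), of u] g(3) s_def by (auto simp: in_keys_iff)
      qed
      then obtain r where r: "p - q - r \<in> ideal B" "keys r \<inter> lead_monoms (ideal B) = {}" "\<forall>u\<in>keys r. ord u s"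
        using 1(1)[of s "p - q"] st by auto
      have "p - r \<in> ideal B" using ideal_add[OF r(1) q] by (simp add: algebra_simps)
      then show ?thesis using r st trans by blast
    next
      case not_lead: False
      define q where "q = p - single s c"
      have "ord u s" if "u \<in> keys q" for u
        using lm_tail[of u p] that lm_greatest[OF False] by (auto simp: q_def c_def s_def)
      then obtain r where r: "q - r \<in> ideal B" "keys r \<inter> lead_monoms (ideal B) = {}" "\<forall>u\<in>keys r. ord u s"
        using 1(1)[of s q] st by auto
      have k: "keys (r + single s c) \<subseteq> insert s (keys r)" using keys_add[of r "single s c"] by (auto split: if_splits)
      show ?thesis
      proof (intro exI[of _ "r + single s c"] conjI)
        show "p - (r + single s c) \<in> ideal B" using r(1) by (simp add: q_def algebra_simps)
        show "keys (r + single s c) \<inter> lead_monoms (ideal B) = {}" using k r(2) not_lead by blast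
        show "\<forall>u\<in>keys (r + single s c). ord u t" using k r(3) st trans by blast
      qed
    qed
  qed
qed

lemma normal_form_exists:
  fixes p :: "('v, 'k::field) mpoly"
  obtains r where "p - r \<in> ideal B" "keys r \<inter> lead_monoms (ideal B) = {}"
proof (cases "p = 0")
  case True
  show ?thesis by (rule that[of 0]) (simp_all add: True)
next
  case False
  define t where "t = lm p + single undefined 1"
  have "ord u t" if "u \<in> keys p" for u
  proof (rule mdeg_less)
    show "mdeg u < mdeg t" using keys_subset_tdeg[OF that] tdeg_eq_mdeg_lm[OF False] by (simp add: t_def)
  qed
  then show ?thesis using normal_form_below[of p t B] that by blast
qed

section \<open>The reduced Groebner basis\<close>

text \<open>
  The element of the reduced Groebner basis with leading monomial \<open>t\<close>: monic, with all other
  monomials outside the leading ideal. This form makes uniqueness immediate, because the difference of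
  two such elements has no monomial in the leading ideal.
\<close>

definition reduced_elem :: "('v, 'k::comm_ring_1) mpoly set \<Rightarrow> 'v monom \<Rightarrow> ('v, 'k) mpoly \<Rightarrow> bool" where
  "reduced_elem I t g \<longleftrightarrow> g \<in> I \<and> lookup g t = 1 \<and> (\<forall>u\<in>keys g. u \<noteq> t \<longrightarrow> u \<notin> lead_monoms I \<and> ord u t)"

lemma reduced_elem_lm:
  assumes "reduced_elem I t g"
  shows "g \<noteq> 0" "lm g = t"
proof -
  show "g \<noteq> 0" using assms by (force simp: reduced_elem_def)
  show "lm g = t" by (rule lmI) (use assms in \<open>auto simp: reduced_elem_def in_keys_iff\<close>)
qed

lemma reduced_elem_unique:
  fixes g h :: "('v, 'k::field) mpoly"
  assumes "reduced_elem (ideal B) t g" "reduced_elem (ideal B) t h"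
  shows "g = h"
proof -
  have "u \<notin> lead_monoms (ideal B)" if "u \<in> keys (g - h)" for u
  proof -
    have "u \<noteq> t" using that assms by (auto simp: reduced_elem_def in_keys_iff lookup_minus)
    moreover have "u \<in> keys g \<or> u \<in> keys h" using that by (auto simp: in_keys_iff lookup_minus)
    ultimately show ?thesis using assms by (auto simp: reduced_elem_def)
  qed
  then have "g - h = 0"
    using assms by (intro eq_zero_if_standard[of _ "ideal B"]) (auto simp: reduced_elem_def intro: ideal_diff)
  then show ?thesis by simp
qed

lemma reduced_elem_exists:
  fixes B :: "('v, 'k::field) mpoly set"
  assumes "t \<in> lead_monoms (ideal B)"
  shows "\<exists>g. reduced_elem (ideal B) t g"
proof -
  obtain p where p: "p \<in> ideal B" "p \<noteq> 0" "t = lm p" using assms by (auto simp: lead_monoms_def)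
  define c where "c = lookup p t"
  have c0: "c \<noteq> 0" using lm_in_keys[OF p(2)] p(3) by (simp add: c_def in_keys_iff)
  define q where "q = p - single t c"
  have "ord u t" if "u \<in> keys q" for u
    using lm_tail[of u p] that lm_greatest[OF p(2)] by (auto simp: q_def c_def p(3))
  then obtain r where r: "q - r \<in> ideal B" "keys r \<inter> lead_monoms (ideal B) = {}" "\<forall>u\<in>keys r. ord u t"
    using normal_form_below[of q t B] by auto
  define g where "g = single 0 (1 / c) * (single t c + r)"
  have rt: "lookup r t = 0" using r(3) irrefl by (meson in_keys_iff)
  have l: "lookup g u = (if u = t then 1 else lookup r u / c)" for u
    using c0 rt by (auto simp: g_def poly_scale_lookup lookup_add lookup_single when_def)
  have "single t c + r = p - (q - r)" by (simp add: q_def)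
  also have "\<dots> \<in> ideal B" using p r by (auto intro: ideal_diff)
  finally have "g \<in> ideal B" by (simp add: g_def ideal_mult)
  then have "reduced_elem (ideal B) t g" using r by (auto simp: reduced_elem_def l in_keys_iff)
  then show ?thesis ..
qed

text \<open>
  Each minimal leading monomial is the leading monomial of some \<open>g \<in> G\<close>, as \<open>G\<close> generates the leading
  ideal. Conversely, if a monomial of \<open>g \<in> G\<close> is divisible by a minimal leading monomial, then the
  element of \<open>G\<close> that belongs to the latter must be \<open>g\<close> itself, since \<open>G\<close> is reduced.
\<close>

lemma reduced_groebner_basis_unique:
  fixes B :: "('v, 'k::field) mpoly set"
  assumes "reduced_groebner_basis ord (ideal B) G"
  shows "G = {g. \<exists>t\<in>min_lead_monoms (ideal B). reduced_elem (ideal B) t g}"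
proof -
  define L where "L = lead_monoms (ideal B)"
  have G: "G \<subseteq> ideal B" "lead_ideal ord G = lead_ideal ord (ideal B)"
    and red: "\<And>g. g \<in> G \<Longrightarrow> g \<noteq> 0 \<and> lookup g (lm g) = 1 \<and>
        (\<forall>t\<in>keys g. single t 1 \<notin> lead_ideal ord (G - {g}))"
    using assms by (auto simp: reduced_groebner_basis_def groebner_basis_def)
  have cover: "\<exists>g\<in>G. lm g = t" if t: "t \<in> min_lead_monoms (ideal B)" for t
  proof -
    have tL: "t \<in> L" using t by (simp add: min_lead_monoms_def L_def)
    then have "single t 1 \<in> lead_ideal ord (ideal B)"
      unfolding single_in_lead_ideal_iff by (metis L_def add_0_right)
    then have "single t 1 \<in> lead_ideal ord G" using G(2) by simp
    then obtain g w where gw: "g \<in> G" "g \<noteq> 0" "t = lm g + w"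
      unfolding single_in_lead_ideal_iff by (auto simp: lead_monoms_def)
    then have "lm g \<in> L" using G(1) by (auto simp: L_def lead_monoms_def)
    then have "w = 0" using t gw(3) by (auto simp: min_lead_monoms_def L_def)
    then show ?thesis using gw by auto
  qed
  have self: "g = h \<and> (\<exists>w. u = lm g + w)" if "g \<in> G" "u \<in> keys g" "u = s + w" "s \<in> min_lead_monoms (ideal B)" "h \<in> G" "lm h = s" for g u s w h
  proof -
    have "g = h"
    proof (rule ccontr)
      assume "g \<noteq> h"
      then have "s \<in> lead_monoms (G - {g})" using that red by (auto simp: lead_monoms_def)
      then have "single u 1 \<in> lead_ideal ord (G - {g})" unfolding single_in_lead_ideal_iff using that by blast
      then show False using red that by blast
    qed
    then show ?thesis using that by blast
  qed
  have elem: "lm g \<in> min_lead_monoms (ideal B) \<and> reduced_elem (ideal B) (lm g) g" if g: "g \<in> G" for g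
  proof -
    have g0: "g \<noteq> 0" and gI: "g \<in> ideal B" using g red G by auto
    then have "lm g \<in> L" by (auto simp: L_def lead_monoms_def)
    then obtain s w where s: "s \<in> min_lead_monoms (ideal B)" "lm g = s + w"
      using min_lead_monom_exists[of "lm g" "ideal B"] by (auto simp: L_def)
    then obtain h where h: "h \<in> G" "lm h = s" using cover by blast
    have "g = h" using self[OF g lm_in_keys[OF g0] s(2) s(1) h] by blast
    then have min: "lm g \<in> min_lead_monoms (ideal B)" using s h by simp
    have "u \<notin> L \<and> ord u (lm g)" if u: "u \<in> keys g" "u \<noteq> lm g" for u
    proof
      show o: "ord u (lm g)" using lm_greatest[OF g0] u by blast
      show "u \<notin> L"
      proof
        assume "u \<in> L"
        then obtain s w where s: "s \<in> min_lead_monoms (ideal B)" "u = s + w"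
          using min_lead_monom_exists[of u "ideal B"] by (auto simp: L_def)
        then obtain h where h: "h \<in> G" "lm h = s" using cover by blast
        obtain w where w: "u = lm g + w" using self[OF g u(1) s(2) s(1) h] by blast
        then have "mdeg w = 0" using mdeg_mono[OF o] by simp
        then show False using w u by simp
      qed
    qed
    then show ?thesis using min gI red[OF g] by (auto simp: reduced_elem_def L_def)
  qed
  show ?thesis
  proof (intro equalityI subsetI)
    fix g assume "g \<in> G"
    then show "g \<in> {g. \<exists>t\<in>min_lead_monoms (ideal B). reduced_elem (ideal B) t g}" using elem by blast
  next
    fix g assume "g \<in> {g. \<exists>t\<in>min_lead_monoms (ideal B). reduced_elem (ideal B) t g}"
    then obtain t where t: "t \<in> min_lead_monoms (ideal B)" "reduced_elem (ideal B) t g" by blast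
    then obtain h where h: "h \<in> G" "lm h = t" using cover by blast
    then have "reduced_elem (ideal B) t h" using elem by blast
    then show "g \<in> G" using reduced_elem_unique t(2) h(1) by blast
  qed
qed

text \<open>
  The set is reduced: a monomial of one element that is divisible by the leading monomial of another
  lies in the leading ideal. So it is the leading monomial \<open>t\<close> of its element, and by minimality \<open>t\<close>
  has no other minimal leading monomial as a divisor.
\<close>

lemma reduced_groebner_basis_exists:
  fixes B :: "('v, 'k::field) mpoly set"
  assumes fin: "finite (min_lead_monoms (ideal B))"
  shows "reduced_groebner_basis ord (ideal B)
           {g. \<exists>t\<in>min_lead_monoms (ideal B). reduced_elem (ideal B) t g}" (is "reduced_groebner_basis _ _ ?G")
proof -
  define M where "M = min_lead_monoms (ideal B)"
  have GI: "?G \<subseteq> ideal B" by (auto simp: reduced_elem_def)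
  have M_sub: "M \<subseteq> lead_monoms (ideal B)" by (auto simp: M_def min_lead_monoms_def)
  have "?G \<subseteq> (\<lambda>t. SOME g. reduced_elem (ideal B) t g) ` M"
  proof
    fix g assume "g \<in> ?G"
    then obtain t where t: "t \<in> M" "reduced_elem (ideal B) t g" by (auto simp: M_def)
    then have "(SOME g. reduced_elem (ideal B) t g) = g"
      using reduced_elem_unique by (metis someI)
    then show "g \<in> (\<lambda>t. SOME g. reduced_elem (ideal B) t g) ` M" using t by force
  qed
  then have finG: "finite ?G" by (rule finite_subset) (simp add: M_def fin)
  have LG: "lead_monoms ?G = M"
  proof
    show "lead_monoms ?G \<subseteq> M" by (auto simp: lead_monoms_def M_def reduced_elem_lm(2))
    show "M \<subseteq> lead_monoms ?G"
    proof
      fix t assume t: "t \<in> M"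
      then obtain g where "reduced_elem (ideal B) t g" using reduced_elem_exists M_sub by blast
      then show "t \<in> lead_monoms ?G" using reduced_elem_lm[of "ideal B" t g] t by (auto simp: lead_monoms_def M_def)
    qed
  qed
  have mi: "lead_ideal ord P = ideal ((\<lambda>s. single s 1) ` lead_monoms P)" for P :: "('v, 'k) mpoly set"
    by (simp add: lead_ideal_def lead_monoms_def image_image)
  have "lead_ideal ord ?G = lead_ideal ord (ideal B)"
  proof
    show "lead_ideal ord ?G \<subseteq> lead_ideal ord (ideal B)"
      unfolding mi LG using M_sub by (intro ideal_mono image_mono)
    have "single t 1 \<in> lead_ideal ord ?G" if "t \<in> lead_monoms (ideal B)" for t
      unfolding single_in_lead_ideal_iff LG M_def using min_lead_monom_exists that by blast
    then show "lead_ideal ord (ideal B) \<subseteq> lead_ideal ord ?G"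
      unfolding mi by (intro ideal_subsetI) auto
  qed
  then have gb: "groebner_basis ord (ideal B) ?G" using finG GI by (simp add: groebner_basis_def)
  have "g \<noteq> 0 \<and> lookup g (lm g) = 1 \<and> (\<forall>u\<in>keys g. single u 1 \<notin> lead_ideal ord (?G - {g}))" if g: "g \<in> ?G" for g
  proof -
    obtain t where t: "t \<in> M" "reduced_elem (ideal B) t g" using g by (auto simp: M_def)
    note lt = reduced_elem_lm[OF t(2)]
    have "single u 1 \<notin> lead_ideal ord (?G - {g})" if u: "u \<in> keys g" for u
    proof
      assume "single u 1 \<in> lead_ideal ord (?G - {g})"
      then obtain h w where h: "h \<in> ?G" "h \<noteq> g" "u = lm h + w"
        unfolding single_in_lead_ideal_iff by (auto simp: lead_monoms_def)
      then obtain s where s: "s \<in> M" "reduced_elem (ideal B) s h" by (auto simp: M_def)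
      then have us: "u = s + w" using h(3) reduced_elem_lm(2) by blast
      then have "u \<in> lead_monoms (ideal B)" using lead_monoms_plus s(1) M_sub by blast
      then have "u = t" using t(2) u by (auto simp: reduced_elem_def)
      moreover have "w = 0" using t(1) us s(1) M_sub \<open>u = t\<close> by (auto simp: M_def min_lead_monoms_def)
      ultimately have "s = t" using us by simp
      then show False using s(2) t(2) h(2) reduced_elem_unique by blast
    qed
    then show ?thesis using lt t(2) by (auto simp: reduced_elem_def)
  qed
  then show ?thesis using gb by (auto simp: reduced_groebner_basis_def)
qed

text \<open>
  A degree bound for the minimal leading monomials gives their finiteness, hence the existence of the
  reduced Groebner basis, and not only a bound for its degrees.
\<close>

theorem max_GB_deg_le:
  fixes P :: "('v, 'k::field) mpoly set"
  assumes bound: "\<And>t. t \<in> min_lead_monoms (ideal P) \<Longrightarrow> mdeg t \<le> N"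
    and nz: "p \<in> P" "p \<noteq> 0"
  shows "max_GB_deg ord P \<le> N"
proof -
  let ?G = "{g. \<exists>t\<in>min_lead_monoms (ideal P). reduced_elem (ideal P) t g}"
  have "finite (min_lead_monoms (ideal P))"
    by (rule finite_subset[OF _ finite_monoms_mdeg_le[of N]]) (use bound in auto)
  then have G: "reduced_groebner_basis ord (ideal P) ?G" by (rule reduced_groebner_basis_exists)
  have GB: "(THE G. reduced_groebner_basis ord (ideal P) G) = ?G"
    by (rule the_equality) (rule G, rule reduced_groebner_basis_unique)
  have fin: "finite ?G" using G by (auto simp: reduced_groebner_basis_def groebner_basis_def)
  have "lm p \<in> lead_monoms (ideal P)" using nz by (auto simp: lead_monoms_def intro: ideal_base)
  then obtain t where "t \<in> min_lead_monoms (ideal P)" using min_lead_monom_exists by blast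
  moreover from this obtain g where "reduced_elem (ideal P) t g"
    using reduced_elem_exists[of t P] by (auto simp: min_lead_monoms_def)
  ultimately have ne: "?G \<noteq> {}" by blast
  have "tdeg g \<le> N" if "g \<in> ?G" for g
    using that bound by (auto simp: reduced_elem_lm tdeg_eq_mdeg_lm[OF reduced_elem_lm(1)])
  then show ?thesis unfolding max_GB_deg_def GB using fin ne by (subst Max_le_iff) auto
qed

end

section \<open>The extra variable\<close>

lemma lookup_ext_monom [simp]:
  "lookup (ext_monom t a) None = a" "lookup (ext_monom t a) (Some x) = lookup t x"
  by (auto simp: ext_monom_def lookup_add lookup_sum lookup_single when_def in_keys_iff)

lemma ext_monom_eq_iff [simp]: "ext_monom t a = ext_monom u b \<longleftrightarrow> t = u \<and> a = b"
  by (metis lookup_ext_monom poly_mapping_eqI)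

lemma ext_monom_eqI: "lookup t' None = a \<Longrightarrow> (\<And>x. lookup t' (Some x) = lookup t x) \<Longrightarrow> t' = ext_monom t a"
  by (rule poly_mapping_eqI) (metis lookup_ext_monom option.exhaust)

lemma ext_monom_cases:
  obtains t a where "t' = ext_monom t a"
proof
  have "inj Some" by simp
  then have "lookup (Poly_Mapping.map_key Some t') x = lookup t' (Some x)" for x
    by (simp add: Poly_Mapping.map_key.rep_eq)
  then show "t' = ext_monom (Poly_Mapping.map_key Some t') (lookup t' None)"
    by (intro ext_monom_eqI) auto
qed

lemma ext_monom_add: "ext_monom t a + ext_monom u b = ext_monom (t + u) (a + b)"
  by (rule ext_monom_eqI) (auto simp: lookup_add)

lemma single_None_eq_ext_monom: "single None a = ext_monom 0 a"
  by (rule ext_monom_eqI) (auto simp: lookup_single)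

lemma mdeg_ext_monom [simp]: "mdeg (ext_monom t a) = mdeg t + a"
  by (simp add: ext_monom_def mdeg_sum mdeg_def[of t])

lemma hom_var_power: "(hom_var :: ('x option, 'k::comm_ring_1) mpoly) ^ k = single (single None k) 1"
  by (induction k) (auto simp: hom_var_def mult_single single_add[symmetric])

lemma hom_var_homogeneous: "(hom_var :: ('x option, 'k::comm_ring_1) mpoly) \<in> homogeneous 1"
  by (simp add: hom_var_def homogeneous_def)

lemma hom_component_hom_var:
  "hom_component (Suc e) (hom_var * (p :: ('x option, 'k::comm_ring_1) mpoly)) = hom_var * hom_component e p"
  by (simp add: hom_component_mult[OF hom_var_homogeneous])

lemma hom_var_mult_homogeneous:
  "p \<in> homogeneous e \<Longrightarrow> hom_var * (p :: ('x option, 'k::comm_ring_1) mpoly) \<in> homogeneous (Suc e)"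
  using homogeneous_mult[OF hom_var_homogeneous, of p e] by simp

text \<open>
  The quotient is written with the truncating subtraction of exponents, which is exact here.
\<close>

lemma factor_monom:
  fixes p :: "('v, 'k::comm_ring_1) mpoly"
  assumes "\<And>t. t \<in> keys p \<Longrightarrow> \<exists>s. t = u + s"
  shows "\<exists>q. p = single u 1 * q"
proof
  have "single u 1 * single (t - u) (lookup p t) = single t (lookup p t)" if "t \<in> keys p" for t
    using assms[OF that] by (auto simp: mult_single)
  then show "p = single u 1 * (\<Sum>t\<in>keys p. single (t - u) (lookup p t))"
    by (simp add: sum_distrib_left sum_single_keys)
qed

text \<open>
  The ring homomorphism \<open>R' \<rightarrow> R\<close> with \<open>y \<mapsto> 0\<close>. It keeps the coefficients of the monomials without
  \<open>y\<close>, so it is the pullback of coefficients along the embedding of the monomials of \<open>R\<close>.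
\<close>

definition y_zero :: "('x option, 'k::zero) mpoly \<Rightarrow> ('x, 'k) mpoly" where
  "y_zero = Poly_Mapping.map_key (\<lambda>t. ext_monom t 0)"

lemma inj_ext_monom: "inj (\<lambda>t. ext_monom t a)"
  by (simp add: inj_def)

lemma lookup_y_zero: "lookup (y_zero p) t = lookup p (ext_monom t 0)"
  by (simp add: y_zero_def Poly_Mapping.map_key.rep_eq[OF inj_ext_monom])

lemma y_zero_zero [simp]: "y_zero 0 = 0"
  by (rule poly_mapping_eqI) (simp add: lookup_y_zero)

lemma y_zero_add: "y_zero (p + q) = y_zero p + y_zero q"
  by (rule poly_mapping_eqI) (simp add: lookup_y_zero lookup_add)

lemma y_zero_diff: "y_zero (p - q :: ('x option, 'k::ab_group_add) mpoly) = y_zero p - y_zero q"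
  by (rule poly_mapping_eqI) (simp add: lookup_y_zero lookup_minus)

lemma y_zero_single: "y_zero (single (ext_monom t a) c) = (if a = 0 then single t c else 0)"
  by (rule poly_mapping_eqI) (auto simp: lookup_y_zero lookup_single when_def)

lemma y_zero_mult: "y_zero (p * q :: ('x option, 'k::comm_ring_1) mpoly) = y_zero p * y_zero q"
proof (induction p rule: poly_induct)
  case (single t' c)
  obtain t a where t: "t' = ext_monom t a" by (rule ext_monom_cases)
  show ?case
  proof (induction q rule: poly_induct)
    case (single u' b)
    obtain u e where u: "u' = ext_monom u e" by (rule ext_monom_cases)
    show ?case by (simp add: t u mult_single ext_monom_add y_zero_single)
  qed (auto simp: y_zero_add distrib_left)
qed (auto simp: y_zero_add distrib_right)

lemma surj_y_zero: "surj (y_zero :: ('x option, 'k::comm_ring_1) mpoly \<Rightarrow> _)"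
proof -
  have "\<exists>q. p = y_zero q" for p :: "('x, 'k) mpoly"
  proof (induction p rule: poly_induct)
    case (single t c)
    have "single t c = y_zero (single (ext_monom t 0) c)" by (simp add: y_zero_single)
    then show ?case by blast
  qed (metis y_zero_zero, metis y_zero_add)
  then show ?thesis by (auto simp: surj_def)
qed

lemma y_zero_hom_var_mult [simp]: "y_zero (hom_var * p :: ('x option, 'k::comm_ring_1) mpoly) = 0"
  by (simp add: y_zero_mult hom_var_def single_None_eq_ext_monom y_zero_single)

lemma y_zero_eq_0D:
  fixes p :: "('x option, 'k::comm_ring_1) mpoly"
  assumes "y_zero p = 0"
  shows "\<exists>q. p = hom_var * q"
  unfolding hom_var_def
proof (rule factor_monom)
  fix t' assume t': "t' \<in> keys p"
  obtain t a where t: "t' = ext_monom t a" by (rule ext_monom_cases)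
  have "lookup (y_zero p) t = 0" using assms by simp
  then have "a \<noteq> 0" using t' t by (intro notI) (simp add: lookup_y_zero in_keys_iff)
  then have "t' = single None 1 + ext_monom t (a - 1)"
    by (simp add: t single_None_eq_ext_monom ext_monom_add)
  then show "\<exists>s. t' = single None 1 + s" ..
qed

lemma y_zero_homogeneous: "p \<in> homogeneous d \<Longrightarrow> y_zero p \<in> homogeneous d"
  by (force simp: homogeneous_def in_keys_iff lookup_y_zero)

lemma ideal_y_zero: "ideal (y_zero ` B) = y_zero ` ideal (B :: ('x option, 'k::comm_ring_1) mpoly set)"
  by (rule ideal_ring_hom_image[symmetric]) (auto simp: y_zero_add y_zero_mult surj_y_zero)

text \<open>
  The kernel of \<open>y_zero\<close> is \<open>y R'\<close>, so membership in an ideal of \<open>R\<close> lifts to membership in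
  \<open>\<langle>B\<rangle> + y R'\<close>.
\<close>

lemma y_zero_in_idealD:
  fixes B :: "('x option, 'k::comm_ring_1) mpoly set"
  assumes "y_zero p \<in> ideal (y_zero ` B)"
  obtains q h where "q \<in> ideal B" "p = q + hom_var * h"
proof -
  obtain q where q: "q \<in> ideal B" "y_zero p = y_zero q" using assms by (auto simp: ideal_y_zero)
  then have "y_zero (p - q) = 0" by (simp add: y_zero_diff)
  then obtain h where "p - q = hom_var * h" using y_zero_eq_0D by blast
  then show ?thesis using that q(1) by (metis add.commute diff_add_cancel)
qed

lemma homogeneous_subset_ideal_mono:
  fixes B :: "('v, 'k::comm_ring_1) mpoly set"
  assumes "homogeneous D \<subseteq> ideal B" "D \<le> e"
  shows "homogeneous e \<subseteq> ideal B"
proof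
  fix p :: "('v, 'k) mpoly" assume p: "p \<in> homogeneous e"
  have "single t (lookup p t) \<in> ideal B" if t: "t \<in> keys p" for t
  proof -
    have "D \<le> mdeg t" using assms(2) homogeneousD[OF p t] by simp
    then obtain s w where "t = s + w" "mdeg s = D" by (rule monom_submonom)
    moreover from this have "single s 1 \<in> ideal B" using assms(1) homogeneous_single by blast
    ultimately show ?thesis using ideal_mult[of "single s 1" B "single w (lookup p t)"]
      by (simp add: mult_single add.commute)
  qed
  then have "(\<Sum>t\<in>keys p. single t (lookup p t)) \<in> ideal B" by (rule ideal_sum)
  then show "p \<in> ideal B" by (simp add: sum_single_keys)
qed

section \<open>Homogenization\<close>

lemma lookup_homogenization:
  "lookup (homogenization p) (ext_monom t a) = (if mdeg t + a = tdeg p then lookup p t else 0)"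
proof -
  have "lookup (homogenization p) (ext_monom t a) =
      (\<Sum>s\<in>keys p. if s = t then (if tdeg p - mdeg t = a then lookup p t else 0) else 0)"
    unfolding homogenization_def lookup_sum by (rule sum.cong) (auto simp: lookup_single when_def)
  also have "\<dots> = (if mdeg t + a = tdeg p then lookup p t else 0)"
    using keys_subset_tdeg[of t p] by (auto simp: in_keys_iff)
  finally show ?thesis .
qed

lemma homogenization_homogeneous: "homogenization p \<in> homogeneous (tdeg p)"
  unfolding homogeneous_def
proof safe
  fix t' assume "t' \<in> keys (homogenization p)"
  moreover obtain t a where "t' = ext_monom t a" by (rule ext_monom_cases)
  ultimately show "mdeg t' = tdeg p" by (auto simp: in_keys_iff lookup_homogenization split: if_splits)
qed

lemma y_zero_homogenization: "y_zero (homogenization p) = top_part p"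
  by (rule poly_mapping_eqI)
     (auto simp: lookup_y_zero lookup_homogenization top_part_def lookup_hom_component)

lemma top_part_nonzero:
  assumes "p \<noteq> 0"
  shows "top_part p \<noteq> 0"
proof -
  have "mdeg ` keys p \<noteq> {}" using assms by simp
  then have "tdeg p \<in> mdeg ` keys p" using assms Max_in[of "mdeg ` keys p"] by (simp add: tdeg_def)
  then obtain t where "t \<in> keys p" "mdeg t = tdeg p" by auto
  then have "t \<in> keys (top_part p)" by (simp add: top_part_def keys_hom_component)
  then show ?thesis by force
qed

lemma homogenization_nonzero: "p \<noteq> 0 \<Longrightarrow> homogenization p \<noteq> 0"
  using top_part_nonzero y_zero_homogenization by (metis y_zero_zero)

lemma constant_poly_if_tdeg_0: "tdeg p = 0 \<Longrightarrow> constant_poly p"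
  unfolding constant_poly_def
proof (intro exI poly_mapping_eqI)
  fix t assume "tdeg p = 0"
  then show "lookup p t = lookup (single 0 (lookup p 0)) t"
    using keys_subset_tdeg[of t p] by (auto simp: lookup_single when_def in_keys_iff)
qed

section \<open>Multiplication by the extra variable modulo an ideal\<close>

definition y_injective_from :: "nat \<Rightarrow> ('x option, 'k::comm_ring_1) mpoly set \<Rightarrow> bool" where
  "y_injective_from N I \<longleftrightarrow> (\<forall>e\<ge>N. \<forall>g\<in>homogeneous e. hom_var * g \<in> I \<longrightarrow> g \<in> I)"

text \<open>
  Induction on the length of the sequence. If \<open>y g = c a\<^sub>r\<close> modulo the earlier elements, then setting
  \<open>y = 0\<close> and using regularity gives \<open>c = k + y b\<close> with \<open>k\<close> in the ideal of the earlier elements.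
  Hence \<open>y (g - b a\<^sub>r)\<close> lies in this ideal, and \<open>y\<close> can be cancelled by the induction hypothesis.
\<close>

lemma y_nonzerodivisor_if_regular:
  fixes a :: "nat \<Rightarrow> ('x option, 'k::field) mpoly"
  assumes reg: "\<And>i g. i \<in> {1..r} \<Longrightarrow> y_zero (a i) * g \<in> ideal (y_zero ` a ` {1..<i}) \<Longrightarrow> g \<in> ideal (y_zero ` a ` {1..<i})"
    and g: "hom_var * g \<in> ideal (a ` {1..r})"
  shows "g \<in> ideal (a ` {1..r})"
  using assms
proof (induction r arbitrary: g)
  case 0
  then show ?case using single_mult_eq_0_iff[of 1 "single None 1" g] by (simp add: hom_var_def)
next
  case (Suc r)
  have set: "a ` {1..Suc r} = insert (a (Suc r)) (a ` {1..r})" by (simp add: atLeastAtMostSuc_conv)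
  have lt: "{1..<Suc r} = {1..r}" by auto
  obtain c where c: "hom_var * g - c * a (Suc r) \<in> ideal (a ` {1..r})"
    using Suc.prems(2) unfolding set ideal_insert by blast
  then have "y_zero (hom_var * g - c * a (Suc r)) \<in> ideal (y_zero ` a ` {1..r})"
    by (simp add: ideal_y_zero)
  moreover have "y_zero (hom_var * g - c * a (Suc r)) = 0 - y_zero (a (Suc r)) * y_zero c"
    by (simp add: y_zero_diff y_zero_mult[of c] mult.commute)
  ultimately have "y_zero (a (Suc r)) * y_zero c \<in> ideal (y_zero ` a ` {1..r})"
    using ideal_diff[OF ideal_zero, of "0 - y_zero (a (Suc r)) * y_zero c"] by simp
  then have "y_zero c \<in> ideal (y_zero ` a ` {1..r})" using Suc.prems(1)[of "Suc r"] lt by simp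
  then obtain k b where k: "k \<in> ideal (a ` {1..r})" "c = k + hom_var * b" by (rule y_zero_in_idealD)
  have "hom_var * (g - b * a (Suc r)) = (hom_var * g - c * a (Suc r)) + k * a (Suc r)"
    by (simp add: k(2) algebra_simps)
  also have "\<dots> \<in> ideal (a ` {1..r})" using c k(1) by (intro ideal_add ideal_mult_right)
  finally have "g - b * a (Suc r) \<in> ideal (a ` {1..r})" using Suc.IH Suc.prems(1) by auto
  then show ?case unfolding set ideal_insert by blast
qed

text \<open>
  In degree \<open>e + 1 > N\<close> the coefficient of a generator \<open>c \<in> C\<close> of degree \<open>d\<close> has degree
  \<open>e + 1 - d \<ge> D\<close>, so it is a multiple of \<open>y\<close> modulo \<open>\<langle>B\<rangle>\<close>. The part of \<open>y g\<close> that comes from \<open>C\<close> is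
  therefore \<open>y q\<close> with \<open>q \<in> \<langle>C\<rangle>\<close> modulo \<open>\<langle>B\<rangle>\<close>, and the injectivity modulo \<open>\<langle>B\<rangle>\<close> applies to \<open>g - q\<close>.
\<close>

lemma y_injective_from_extend:
  fixes B C :: "('x option, 'k::field) mpoly set"
  assumes hB: "\<And>b. b \<in> B \<Longrightarrow> \<exists>d. b \<in> homogeneous d"
    and inj: "y_injective_from N (ideal B)"
    and fill: "homogeneous D \<subseteq> ideal (y_zero ` B)"
    and hC: "\<And>c. c \<in> C \<Longrightarrow> \<exists>d. c \<in> homogeneous d \<and> D + d \<le> N + 1"
  shows "y_injective_from N (ideal (B \<union> C))"
  unfolding y_injective_from_def
proof (intro allI impI ballI)
  fix e and g :: "('x option, 'k) mpoly"
  assume e: "N \<le> e" and g: "g \<in> homogeneous e" and yg: "hom_var * g \<in> ideal (B \<union> C)"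
  have lift: "\<exists>q\<in>ideal C. p - hom_var * q \<in> ideal B"
    if "p' \<in> ideal C" "p = hom_component (Suc e) p'" for p p'
    using that
  proof (induction arbitrary: p rule: ideal_induct)
    case zero
    then show ?case by (intro bexI[of _ 0]) auto
  next
    case (step k c p')
    obtain d where d: "c \<in> homogeneous d" "D + d \<le> N + 1" using hC step(1) by blast
    obtain q where q: "q \<in> ideal C" "hom_component (Suc e) p' - hom_var * q \<in> ideal B"
      using step(3)[OF refl] by blast
    define k' where "k' = hom_component (Suc e - d) k"
    have "d \<le> Suc e" using d e by simp
    then have p: "p = c * k' + hom_component (Suc e) p'"
      by (simp add: step(4) hom_component_add mult.commute[of k] hom_component_mult[OF d(1)] k'_def)
    have "D \<le> Suc e - d" using d e by simp
    then have "y_zero k' \<in> ideal (y_zero ` B)"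
      using homogeneous_subset_ideal_mono[OF fill] y_zero_homogeneous[of k' "Suc e - d"] k'_def by auto
    then obtain b h where bh: "b \<in> ideal B" "k' = b + hom_var * h" by (rule y_zero_in_idealD)
    have "p - hom_var * (c * h + q) = c * b + (hom_component (Suc e) p' - hom_var * q)"
      by (simp add: p bh(2) algebra_simps)
    also have "\<dots> \<in> ideal B" using bh(1) q(2) by (intro ideal_add ideal_mult)
    finally have "p - hom_var * (c * h + q) \<in> ideal B" .
    moreover have "c * h + q \<in> ideal C" using q(1) step(1) by (auto intro: ideal_add ideal_mult_right ideal_base)
    ultimately show ?case by blast
  qed
  obtain b p' where bp: "b \<in> ideal B" "p' \<in> ideal C" "hom_var * g = b + p'"
    using yg by (auto simp: ideal_Un)
  obtain q where q: "q \<in> ideal C" "hom_component (Suc e) p' - hom_var * q \<in> ideal B"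
    using lift[OF bp(2) refl] by blast
  have "hom_var * g = hom_component (Suc e) (hom_var * g)"
    by (rule hom_component_same[symmetric, OF hom_var_mult_homogeneous[OF g]])
  also have "\<dots> = hom_component (Suc e) b + hom_component (Suc e) p'" by (simp add: bp(3) hom_component_add)
  finally have "hom_var * (g - q) = hom_component (Suc e) b + (hom_component (Suc e) p' - hom_var * q)"
    by (simp add: algebra_simps)
  also have "\<dots> \<in> ideal B" using q(2) ideal_hom_component[OF hB bp(1)] by (intro ideal_add)
  finally have "hom_component (Suc e) (hom_var * (g - q)) \<in> ideal B" using ideal_hom_component[of B, OF hB] by blast
  then have "hom_var * hom_component e (g - q) \<in> ideal B" by (simp add: hom_component_hom_var)
  then have "hom_component e (g - q) \<in> ideal B" using inj e by (auto simp: y_injective_from_def)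
  then have "g - hom_component e q \<in> ideal (B \<union> C)"
    using ideal_mono[of B "B \<union> C"] by (auto simp: hom_component_diff hom_component_same[OF g])
  moreover have "hom_component e q \<in> ideal C" by (rule ideal_hom_component[OF _ q(1)]) (use hC in blast)
  then have "hom_component e q \<in> ideal (B \<union> C)" using ideal_mono[of C "B \<union> C"] by blast
  ultimately show "g \<in> ideal (B \<union> C)" by (rule ideal_diff_cancel)
qed

section \<open>The degree reverse lexicographic ordering and its homogenization\<close>

lemma graded_monomial_order_drl: "graded_monomial_order (drl :: 'v::{finite,linorder} monom \<Rightarrow> 'v monom \<Rightarrow> bool)"
proof
  fix s t u :: "'v monom"
  show "\<not> drl t t" by (simp add: drl_def)
  show "mdeg s < mdeg t \<Longrightarrow> drl s t" by (simp add: drl_def)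
  show "drl s t \<Longrightarrow> drl (u + s) (u + t)" by (auto simp: drl_def lookup_add)
  show "drl s u" if st: "drl s t" and tu: "drl t u"
  proof (cases "mdeg s < mdeg u")
    case True
    then show ?thesis by (simp add: drl_def)
  next
    case False
    then have m: "mdeg s = mdeg t" "mdeg t = mdeg u" using st tu by (auto simp: drl_def)
    obtain v where v: "lookup s v > lookup t v" "\<forall>x<v. lookup s x = lookup t x"
      using st m by (auto simp: drl_def)
    obtain w where w: "lookup t w > lookup u w" "\<forall>x<w. lookup t x = lookup u x"
      using tu m by (auto simp: drl_def)
    have "lookup s (min v w) > lookup u (min v w)" "\<forall>x<min v w. lookup s x = lookup u x"
      using v w by (cases v w rule: linorder_cases; auto simp: min_def)+
    then show ?thesis using m by (auto simp: drl_def)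
  qed
  show "drl s t \<or> drl t s" if "s \<noteq> t"
  proof -
    define A where "A = {x. lookup s x \<noteq> lookup t x}"
    have "A \<noteq> {}" using that by (auto simp: A_def poly_mapping_eq_iff fun_eq_iff)
    then obtain v where "v \<in> A" "\<And>x. x < v \<Longrightarrow> x \<notin> A"
      using Min_in[of A] Min_le[of A] by (meson finite leD)
    then have v: "lookup s v \<noteq> lookup t v" "\<And>x. x < v \<Longrightarrow> lookup s x = lookup t x" by (auto simp: A_def)
    show ?thesis
    proof (cases "lookup s v < lookup t v")
      case True
      then show ?thesis using v(2) unfolding drl_def by (metis linorder_cases)
    next
      case False
      then have "lookup t v < lookup s v" using v(1) by simp
      then show ?thesis using v(2) unfolding drl_def by (metis linorder_cases)
    qed
  qed
qed

text \<open>
  The representation of a monomial as \<open>t * y ^ a\<close> is unique, so the existential quantifiers disappear.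
\<close>

lemma homogenized_ord_ext_monom:
  "homogenized_ord ord (ext_monom t a) (ext_monom u b) \<longleftrightarrow>
     mdeg t + a < mdeg u + b \<or> (mdeg t + a = mdeg u + b \<and> ord t u)"
  by (auto simp: homogenized_ord_def)

text \<open>
  What follows holds for the homogenization of any degree-compatible ordering: if two monomials have the same
  total degree and the first has the smaller exponent of \<open>y\<close>, then its part in \<open>R\<close> has the larger
  degree, and so it is the larger one.
\<close>

locale homogenized_monomial_order = base: graded_monomial_order ord
  for ord :: "'x::finite monom \<Rightarrow> 'x monom \<Rightarrow> bool"
begin

sublocale graded_monomial_order "homogenized_ord ord"
proof
  fix s' t' u' :: "'x option monom"
  obtain s a where s: "s' = ext_monom s a" by (rule ext_monom_cases)
  obtain t b where t: "t' = ext_monom t b" by (rule ext_monom_cases)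
  obtain u c where u: "u' = ext_monom u c" by (rule ext_monom_cases)
  show "\<not> homogenized_ord ord t' t'" using base.irrefl by (simp add: t homogenized_ord_ext_monom)
  show "homogenized_ord ord s' t' \<Longrightarrow> homogenized_ord ord t' u' \<Longrightarrow> homogenized_ord ord s' u'"
    by (auto simp: s t u homogenized_ord_ext_monom intro: base.trans)
  show "s' \<noteq> t' \<Longrightarrow> homogenized_ord ord s' t' \<or> homogenized_ord ord t' s'"
    using base.total[of s t] by (cases "s = t") (auto simp: s t homogenized_ord_ext_monom)
  show "homogenized_ord ord s' t' \<Longrightarrow> homogenized_ord ord (u' + s') (u' + t')"
    by (auto simp: s t u homogenized_ord_ext_monom ext_monom_add intro: base.plus_mono)
  show "mdeg s' < mdeg t' \<Longrightarrow> homogenized_ord ord s' t'"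
    by (simp add: s t homogenized_ord_ext_monom)
qed

text \<open>
  The characteristic property of reverse lexicographic orderings: all other monomials of \<open>g\<close> are
  smaller and of the same degree, so they contain at least the same power of \<open>y\<close>.
\<close>

lemma y_power_dvd_if_dvd_lm:
  fixes g :: "('x option, 'k::comm_ring_1) mpoly"
  assumes g: "g \<in> homogeneous e" "g \<noteq> 0" and a: "lm g = ext_monom u a"
  shows "\<exists>h. g = single (single None a) 1 * h"
proof (rule factor_monom)
  fix v assume v: "v \<in> keys g"
  obtain s b where s: "v = ext_monom s b" by (rule ext_monom_cases)
  have "mdeg (ext_monom s b) = mdeg (ext_monom u a)"
    using homogeneousD[OF g(1)] v lm_in_keys[OF g(2)] s a by metis
  moreover have "v = lm g \<or> homogenized_ord ord v (lm g)" using lm_greatest[OF g(2) v] by blast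
  ultimately have "a \<le> b" using base.mdeg_mono[of s u] by (auto simp: s a homogenized_ord_ext_monom)
  then have "v = single None a + ext_monom s (b - a)"
    by (simp add: s single_None_eq_ext_monom ext_monom_add)
  then show "\<exists>w. v = single None a + w" ..
qed

text \<open>
  The monomial is an element \<open>q\<close> of the ideal plus a multiple of \<open>y\<close>. In its own degree, \<open>q\<close> consists of this
  monomial and of monomials divisible by \<open>y\<close>, which are smaller.
\<close>

lemma y_free_lead_monom:
  fixes B :: "('x option, 'k::field) mpoly set"
  assumes hB: "\<And>b. b \<in> B \<Longrightarrow> \<exists>d. b \<in> homogeneous d"
    and fill: "homogeneous D \<subseteq> ideal (y_zero ` B)" and u: "D \<le> mdeg u"
  shows "ext_monom u 0 \<in> lead_monoms (ideal B)"
proof -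
  let ?e = "mdeg u"
  let ?m = "single (ext_monom u 0) (1::'k)"
  have "y_zero ?m \<in> ideal (y_zero ` B)"
    using homogeneous_subset_ideal_mono[OF fill u] homogeneous_single[of u ?e "1::'k"]
    by (auto simp: y_zero_single)
  then obtain q h where q: "q \<in> ideal B" "?m = q + hom_var * h" by (rule y_zero_in_idealD)
  have "y_zero q = y_zero ?m" by (simp add: q(2) y_zero_add)
  then have free: "lookup q (ext_monom s 0) = lookup ?m (ext_monom s 0)" for s
    by (metis lookup_y_zero)
  define p where "p = hom_component ?e q"
  have p: "p \<in> ideal B" unfolding p_def using ideal_hom_component[of B, OF hB q(1)] by blast
  have k: "ext_monom u 0 \<in> keys p" by (simp add: p_def in_keys_iff lookup_hom_component free)
  have "lm p = ext_monom u 0"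
  proof (rule lmI[OF k])
    fix v assume v: "v \<in> keys p" "v \<noteq> ext_monom u 0"
    obtain s b where s: "v = ext_monom s b" by (rule ext_monom_cases)
    have deg: "mdeg s + b = mdeg u" and nz: "lookup q v \<noteq> 0"
      using v(1) by (auto simp: p_def s in_keys_iff lookup_hom_component split: if_splits)
    have "b \<noteq> 0"
    proof
      assume "b = 0"
      then show False using nz v(2) by (auto simp: s free lookup_single when_def split: if_splits)
    qed
    then show "homogenized_ord ord v (ext_monom u 0)"
      using deg base.mdeg_less[of s u] by (simp add: s homogenized_ord_ext_monom)
  qed
  moreover have "p \<noteq> 0" using k by force
  ultimately show ?thesis using p unfolding lead_monoms_def by force
qed

lemma lead_monom_homogeneous_witness:
  fixes B :: "('x option, 'k::field) mpoly set"
  assumes hB: "\<And>b. b \<in> B \<Longrightarrow> \<exists>d. b \<in> homogeneous d"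
    and t: "t \<in> lead_monoms (ideal B)"
  obtains g where "g \<in> ideal B" "g \<noteq> 0" "lm g = t" "g \<in> homogeneous (mdeg t)"
proof -
  obtain p where p: "p \<in> ideal B" "p \<noteq> 0" "t = lm p" using t by (auto simp: lead_monoms_def)
  show ?thesis
    by (rule that[of "hom_component (mdeg t) p"])
       (use ideal_hom_component[of B, OF hB p(1)] lm_hom_component[OF p(2)] p(3) in auto)
qed

text \<open>
  A part \<open>u\<close> of degree at least \<open>D\<close> has a divisor of degree exactly \<open>D\<close>, which is a leading monomial;
  by minimality the two coincide and \<open>a = 0\<close>.
\<close>

lemma y_free_min_lead_monom:
  fixes B :: "('x option, 'k::field) mpoly set"
  assumes hB: "\<And>b. b \<in> B \<Longrightarrow> \<exists>d. b \<in> homogeneous d"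
    and fill: "homogeneous D \<subseteq> ideal (y_zero ` B)"
    and t: "ext_monom u a \<in> min_lead_monoms (ideal B)"
  shows "if a = 0 then mdeg u \<le> D else mdeg u < D"
proof (rule ccontr)
  assume n: "\<not> ?thesis"
  then have D: "D \<le> mdeg u" by (auto split: if_splits)
  then obtain s w where s: "u = s + w" "mdeg s = D" by (rule monom_submonom)
  have "ext_monom s 0 \<in> lead_monoms (ideal B)" using y_free_lead_monom[of B, OF hB fill] s(2) by auto
  moreover have "ext_monom u a = ext_monom s 0 + ext_monom w a" by (simp add: s ext_monom_add)
  ultimately have "ext_monom w a = 0" using t by (auto simp: min_lead_monoms_def)
  then have "mdeg (ext_monom w a) = 0" by simp
  then have "a = 0" "w = 0" by (auto simp: mdeg_ext_monom)
  then show False using n s by simp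
qed

text \<open>
  A minimal leading monomial of degree above \<open>N \<ge> D\<close> is divisible by \<open>y\<close>. It is the leading monomial
  of some \<open>y h\<close> in the ideal, and injectivity puts \<open>h\<close> into the ideal, against minimality.
\<close>

lemma min_lead_monom_mdeg_le:
  fixes B :: "('x option, 'k::field) mpoly set"
  assumes hB: "\<And>b. b \<in> B \<Longrightarrow> \<exists>d. b \<in> homogeneous d"
    and fill: "homogeneous D \<subseteq> ideal (y_zero ` B)"
    and inj: "y_injective_from N (ideal B)" and DN: "D \<le> N"
    and t': "t' \<in> min_lead_monoms (ideal B)"
  shows "mdeg t' \<le> N"
proof (rule ccontr)
  assume big: "\<not> mdeg t' \<le> N"
  obtain u a where t: "t' = ext_monom u a" by (rule ext_monom_cases)
  have a: "a \<noteq> 0" using y_free_min_lead_monom[of B D u a, OF hB fill] t' t big DN by (auto split: if_splits)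
  obtain g where g: "g \<in> ideal B" "g \<noteq> 0" "lm g = t'" "g \<in> homogeneous (mdeg t')"
    using lead_monom_homogeneous_witness[of B, OF hB] t' by (auto simp: min_lead_monoms_def)
  obtain h0 where h0: "g = single (single None a) 1 * h0"
    using y_power_dvd_if_dvd_lm[OF g(4,2)] g(3) t by auto
  define h where "h = hom_component (mdeg t' - 1) (single (single None (a - 1)) 1 * h0)"
  have "g = hom_var * (single (single None (a - 1)) 1 * h0)"
    using a by (simp add: h0 hom_var_def mult.assoc[symmetric] mult_single single_add[symmetric])
  then have "hom_component (Suc (mdeg t' - 1)) g = hom_var * h"
    by (simp only: hom_component_hom_var h_def)
  then have gh: "g = hom_var * h" using big hom_component_same[OF g(4)] by simp
  have "N \<le> mdeg t' - 1" "h \<in> homogeneous (mdeg t' - 1)" using big by (simp_all add: h_def)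
  then have "h \<in> ideal B" using inj g(1) gh unfolding y_injective_from_def by blast
  moreover have h: "h \<noteq> 0" using g(2) gh by auto
  ultimately have "lm h \<in> lead_monoms (ideal B)" by (auto simp: lead_monoms_def)
  moreover have "t' = lm h + single None 1"
    using gh g(3) lm_single_mult[of "1::'k" h "single None 1"] h by (simp add: hom_var_def add.commute)
  ultimately have "single None 1 = (0 :: 'x option monom)" using t' by (auto simp: min_lead_monoms_def)
  then show False by (metis mdeg_single mdeg_zero zero_neq_one)
qed

section \<open>Saturation\<close>

lemma colon_power_subset_saturation: "0 < k \<Longrightarrow> colon I (a ^ k) \<subseteq> saturation I a"
  unfolding saturation_def by (rule UN_upper) simp

text \<open>
  This proves that the ascending chain of the ideals \<open>I : y\<^sup>k\<close> stabilizes in the case where \<open>R/\<langle>y_zero ` B\<rangle>\<close>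
  has finite length. Outside the leading ideal only finitely many \<open>u\<close> can occur in monomials \<open>u y\<^sup>c\<close>,
  namely those of degree below \<open>D\<close>. For each of them either no or almost every power of \<open>y\<close> leads to
  a leading monomial. In degrees at least \<open>s\<close> the exponent \<open>c\<close> is so large that
  if \<open>u y\<^sup>c\<close> times some power of \<open>y\<close> is a leading monomial, then so is \<open>u y\<^sup>c\<close>. Hence \<open>y\<close> is a
  nonzerodivisor on \<open>R'/I\<close> in these degrees, and multiplication by \<open>y\<^sup>s\<close> leads there.
\<close>

lemma sat_index_exists:
  fixes B :: "('x option, 'k::field) mpoly set"
  assumes hB: "\<And>b. b \<in> B \<Longrightarrow> \<exists>d. b \<in> homogeneous d"
    and fill: "homogeneous D \<subseteq> ideal (y_zero ` B)"
  shows "\<exists>s>0. colon (ideal B) (hom_var ^ s) = saturation (ideal B) hom_var"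
proof -
  let ?L = "lead_monoms (ideal B)"
  define U where "U = {u :: 'x monom. mdeg u \<le> D \<and> (\<exists>a. ext_monom u a \<in> ?L)}"
  define low where "low u = (SOME a. ext_monom u a \<in> ?L)" for u
  have low: "ext_monom u (low u) \<in> ?L" if "u \<in> U" for u
    using that someI_ex[of "\<lambda>a. ext_monom u a \<in> ?L"] by (auto simp: U_def low_def)
  have finU: "finite U" by (rule finite_subset[OF _ finite_monoms_mdeg_le[of D]]) (auto simp: U_def)
  define s where "s = Suc (D + (\<Sum>u\<in>U. low u))"
  have high: "g \<in> ideal B" if g: "g \<in> homogeneous e" "s \<le> e" "hom_var ^ k * g \<in> ideal B" for g e k
  proof -
    \<comment> \<open>It suffices to consider the normal form of \<open>g\<close>, which has the same degree.\<close>
    obtain r0 where r0: "g - r0 \<in> ideal B" "keys r0 \<inter> ?L = {}" by (rule normal_form_exists)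
    define r where "r = hom_component e r0"
    have "hom_component e (g - r0) \<in> ideal B" using ideal_hom_component[of B, OF hB r0(1)] by blast
    then have gr: "g - r \<in> ideal B" by (simp add: hom_component_diff hom_component_same[OF g(1)] r_def)
    have rL: "keys r \<inter> ?L = {}" using r0(2) by (auto simp: r_def keys_hom_component)
    have "hom_var ^ k * r = hom_var ^ k * g - hom_var ^ k * (g - r)" by (simp add: algebra_simps)
    also have "\<dots> \<in> ideal B" using ideal_diff[OF g(3) ideal_mult[OF gr]] .
    finally have yr: "single (single None k) 1 * r \<in> ideal B" by (simp add: hom_var_power)
    have "r = 0"
    proof (rule ccontr)
      assume r: "r \<noteq> 0"
      obtain u c where u: "lm r = ext_monom u c" by (rule ext_monom_cases)
      have nL: "ext_monom u c \<notin> ?L" using lm_in_keys[OF r] rL u by auto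
      have "mdeg (lm r) = e" using lm_in_keys[OF r] by (simp add: r_def keys_hom_component)
      then have e: "mdeg u + c = e" using u by simp
      have "\<not> D \<le> mdeg u"
      proof
        assume "D \<le> mdeg u"
        then have "ext_monom u 0 + ext_monom 0 c \<in> ?L"
          using y_free_lead_monom[of B, OF hB fill] by (intro lead_monoms_plus) auto
        then show False using nL by (simp add: ext_monom_add)
      qed
      moreover have "lm (single (single None k) 1 * r) \<in> ?L"
        using yr r single_mult_eq_0_iff[of "1::'k"] by (auto simp: lead_monoms_def)
      then have "ext_monom u (k + c) \<in> ?L"
        using r by (simp add: lm_single_mult u single_None_eq_ext_monom ext_monom_add)
      ultimately have uU: "u \<in> U" by (auto simp: U_def)
      then have "low u \<le> (\<Sum>u\<in>U. low u)" using finU by (intro member_le_sum) auto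
      then have "low u \<le> c" using e g(2) \<open>\<not> D \<le> mdeg u\<close> by (simp add: s_def)
      then have "ext_monom u c = ext_monom u (low u) + ext_monom 0 (c - low u)" by (simp add: ext_monom_add)
      then show False using nL lead_monoms_plus[OF low[OF uU]] by simp
    qed
    then show ?thesis using gr by simp
  qed
  have "saturation (ideal B) hom_var \<subseteq> colon (ideal B) (hom_var ^ s)"
  proof
    fix g assume "g \<in> saturation (ideal B) hom_var"
    then obtain k where gk: "g * hom_var ^ k \<in> ideal B" by (auto simp: saturation_def colon_def)
    have yp: "(hom_var :: ('x option, 'k) mpoly) ^ k \<in> homogeneous k" for k
      by (simp add: hom_var_power homogeneous_single)
    have "hom_var ^ s * hom_component e g \<in> ideal B" for e
    proof (rule high)
      show "hom_var ^ s * hom_component e g \<in> homogeneous (s + e)"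
        by (rule homogeneous_mult[OF yp hom_component_homogeneous])
      have "hom_component (k + e) (hom_var ^ k * g) \<in> ideal B"
        using ideal_hom_component[of B, OF hB gk] by (simp add: mult.commute)
      then have "hom_var ^ k * hom_component e g \<in> ideal B" by (simp add: hom_component_mult[OF yp])
      then show "hom_var ^ k * (hom_var ^ s * hom_component e g) \<in> ideal B"
        using ideal_mult by (metis mult.left_commute)
    qed simp
    then have "(\<Sum>e\<le>tdeg g. hom_var ^ s * hom_component e g) \<in> ideal B" by (intro ideal_sum)
    then have "hom_var ^ s * g \<in> ideal B" by (simp only: sum_distrib_left[symmetric] sum_hom_component)
    then show "g \<in> colon (ideal B) (hom_var ^ s)" by (simp add: colon_def mult.commute)
  qed
  moreover have "0 < s" by (simp add: s_def)
  ultimately show ?thesis using colon_power_subset_saturation by blast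
qed

text \<open>
  If the degree is at least \<open>D + s\<close>, then the exponent \<open>a\<close> of \<open>y\<close> exceeds \<open>s\<close>, and
  \<open>I : y\<^sup>a = I : y\<^sup>s\<close> allows one to replace \<open>y\<^sup>a\<close> by \<open>y\<^sup>s\<close>: a proper divisor is also a
  leading monomial.
\<close>

lemma min_lead_monom_mdeg_saturation:
  fixes B :: "('x option, 'k::field) mpoly set"
  assumes hB: "\<And>b. b \<in> B \<Longrightarrow> \<exists>d. b \<in> homogeneous d"
    and fill: "homogeneous D \<subseteq> ideal (y_zero ` B)"
    and s: "0 < s" "colon (ideal B) (hom_var ^ s) = saturation (ideal B) hom_var"
    and t': "t' \<in> min_lead_monoms (ideal B)"
  shows "mdeg t' < D + s"
proof (rule ccontr)
  assume big: "\<not> mdeg t' < D + s"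
  obtain u a where t: "t' = ext_monom u a" by (rule ext_monom_cases)
  have "if a = 0 then mdeg u \<le> D else mdeg u < D" using y_free_min_lead_monom[of B, OF hB fill] t' t by blast
  then have a: "s < a" using big s(1) t by (auto split: if_splits)
  obtain g where g: "g \<in> ideal B" "g \<noteq> 0" "lm g = t'" "g \<in> homogeneous (mdeg t')"
    using lead_monom_homogeneous_witness[of B, OF hB] t' by (auto simp: min_lead_monoms_def)
  obtain h where h: "g = single (single None a) 1 * h"
    using y_power_dvd_if_dvd_lm[OF g(4,2)] g(3) t by auto
  have h0: "h \<noteq> 0" using g(2) h by auto
  have "h \<in> colon (ideal B) (hom_var ^ a)" using g(1) h by (simp add: colon_def hom_var_power mult.commute)
  then have "h \<in> colon (ideal B) (hom_var ^ s)" using colon_power_subset_saturation[of a] a s(2) by fastforce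
  then have "single (single None s) 1 * h \<in> ideal B" by (simp add: colon_def hom_var_power mult.commute)
  then have "lm (single (single None s) 1 * h) \<in> lead_monoms (ideal B)"
    using h0 single_mult_eq_0_iff[of "1::'k"] by (auto simp: lead_monoms_def)
  then have "single None s + lm h \<in> lead_monoms (ideal B)" using h0 by (simp add: lm_single_mult)
  moreover have "t' = (single None s + lm h) + single None (a - s)"
  proof -
    have "t' = single None a + lm h" using g(3) h h0 by (simp add: lm_single_mult)
    also have "single None a = (single None s + single None (a - s) :: 'x option monom)"
      using a by (simp add: single_add[symmetric])
    finally show ?thesis by (simp add: ac_simps)
  qed
  ultimately have "single None (a - s) = (0 :: 'x option monom)" using t' by (auto simp: min_lead_monoms_def)
  then have "mdeg (single None (a - s) :: 'x option monom) = 0" by simp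
  then show False using a by (simp del: mdeg_eq_0_iff)
qed

end

section \<open>Dimensions of graded pieces\<close>

context vector_space
begin

text \<open>
  The kernel of the map \<open>(p, q) \<mapsto> p + f q\<close> on \<open>I \<times> V\<close> is isomorphic to \<open>A\<close>. On the level of bases: if \<open>B'\<close> is
  a basis of \<open>V\<close> that extends a basis \<open>B\<close> of \<open>A\<close>, then \<open>f ` (B' - B)\<close> extends a basis of
  \<open>I\<close> to a basis of the sum.
\<close>

lemma dim_sum_image:
  assumes add: "\<And>x y. f (x + y) = f x + f y" and scale: "\<And>c x. f (c *s x) = c *s f x"
    and I: "subspace I" "I \<subseteq> span F" "finite F"
    and V: "subspace V" "V \<subseteq> span H" "finite H"
    and A: "subspace A" "A \<subseteq> V" "\<And>q. q \<in> V \<Longrightarrow> f q \<in> I \<longleftrightarrow> q \<in> A"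
  shows "dim {p + f q |p q. p \<in> I \<and> q \<in> V} + dim A = dim I + dim V"
proof -
  interpret f: module_hom scale scale f by unfold_locales (auto simp: add scale)
  obtain B0 where B0: "B0 \<subseteq> I" "independent B0" "I \<subseteq> span B0" "card B0 = dim I" by (rule basis_exists)
  obtain B where B: "B \<subseteq> A" "independent B" "A \<subseteq> span B" "card B = dim A" by (rule basis_exists)
  obtain B' where B': "B \<subseteq> B'" "B' \<subseteq> V" "independent B'" "V \<subseteq> span B'"
    using maximal_independent_subset_extend[of B V] B A(2) by blast
  have finB0: "finite B0" using independent_span_bound[OF I(3) B0(2)] B0(1) I(2) by blast
  have finB': "finite B'" using independent_span_bound[OF V(3) B'(3)] B'(2) V(2) by blast
  have spB0: "span B0 = I" using B0 I(1) by (intro span_subspace)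
  have "card (B0 \<union> f ` C) = card B0 + card C \<and> independent (B0 \<union> f ` C)"
    if "finite C" "C \<subseteq> B' - B" for C
    using that
  proof (induction C rule: finite_induct)
    case empty
    then show ?case using B0(2) by simp
  next
    case (insert c C)
    have new: "f c \<notin> span (B0 \<union> f ` C)"
    proof
      assume "f c \<in> span (B0 \<union> f ` C)"
      then obtain p q where pq: "p \<in> I" "q \<in> span C" "f c = p + f q"
        by (auto simp: span_Un f.span_image spB0)
      have "C \<subseteq> V" using insert B'(2) by blast
      then have "q \<in> V" using pq(2) span_minimal[OF _ V(1)] by blast
      moreover have "c \<in> V" using insert B'(2) by blast
      ultimately have cq: "c - q \<in> V" using V(1) by (simp add: subspace_diff)
      have "f (c - q) = p" using pq(3) by (simp add: f.diff)
      then have "c - q \<in> A" using A(3)[OF cq] pq(1) by simp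
      then have "c - q \<in> span (B \<union> C)" using B(3) span_mono[of B "B \<union> C"] by blast
      moreover have "q \<in> span (B \<union> C)" using pq(2) span_mono[of C "B \<union> C"] by blast
      ultimately have "c \<in> span (B \<union> C)" using span_add[of "c - q" "B \<union> C" q] by simp
      moreover have "B \<union> C \<subseteq> B' - {c}" using insert B'(1) by blast
      ultimately have "c \<in> span (B' - {c})" using span_mono by blast
      then show False using B'(3) insert(4) unfolding dependent_def by blast
    qed
    have "f c \<notin> B0 \<union> f ` C" using new by (rule contrapos_nn) (rule span_base)
    moreover have "independent (insert (f c) (B0 \<union> f ` C))"
      using new insert by (intro independent_insertI) auto
    moreover have "finite (B0 \<union> f ` C)" using finB0 insert(1) by simp
    moreover have "card (B0 \<union> f ` C) = card B0 + card C" using insert by simp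
    moreover have "B0 \<union> f ` insert c C = insert (f c) (B0 \<union> f ` C)" by simp
    ultimately show ?case using insert(1,2) by (metis add_Suc_right card_insert_disjoint)
  qed
  from this[of "B' - B"] finB'
  have E: "card (B0 \<union> f ` (B' - B)) = card B0 + card (B' - B)" "independent (B0 \<union> f ` (B' - B))" by auto
  have "dim {p + f q |p q. p \<in> I \<and> q \<in> V} = card B0 + card (B' - B)"
  proof (rule dim_unique[OF _ _ E(2) E(1)])
    have z: "0 \<in> I" "0 \<in> V" using I(1) V(1) by (auto simp: subspace_0)
    show "B0 \<union> f ` (B' - B) \<subseteq> {p + f q |p q. p \<in> I \<and> q \<in> V}"
    proof
      fix x assume "x \<in> B0 \<union> f ` (B' - B)"
      then show "x \<in> {p + f q |p q. p \<in> I \<and> q \<in> V}"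
      proof
        assume "x \<in> B0"
        then have "x = x + f 0" "x \<in> I" using B0(1) by (auto simp: f.zero)
        then show ?thesis using z by blast
      next
        assume "x \<in> f ` (B' - B)"
        then obtain q where "x = 0 + f q" "q \<in> V" using B'(2) by auto
        then show ?thesis using z by blast
      qed
    qed
    have "p + f q \<in> span (B0 \<union> f ` (B' - B))" if "p \<in> I" "q \<in> V" for p q
    proof -
      have "q \<in> span (B \<union> (B' - B))" using that(2) B'(1,4) by (auto simp: Un_absorb1)
      then obtain a c where ac: "a \<in> span B" "c \<in> span (B' - B)" "q = a + c" unfolding span_Un by blast
      have "a \<in> A" using ac(1) span_minimal[OF B(1) A(1)] by blast
      then have "f a \<in> I" using A(2,3) by blast
      then have "p + f a \<in> span B0" using that(1) spB0 I(1) by (simp add: subspace_add)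
      moreover have "f c \<in> span (f ` (B' - B))" using ac(2) by (simp add: f.span_image)
      moreover have "p + f q = (p + f a) + f c" by (simp add: ac(3) add ac_simps)
      ultimately show ?thesis unfolding span_Un by blast
    qed
    then show "{p + f q |p q. p \<in> I \<and> q \<in> V} \<subseteq> span (B0 \<union> f ` (B' - B))" by blast
  qed
  moreover have "card B' = dim V" using B' by (intro basis_card_eq_dim)
  moreover have "card (B' - B) + card B = card B'"
    using B'(1) finB' by (metis card_Diff_subset card_mono finite_subset le_add_diff_inverse2)
  ultimately show ?thesis using B0(4) B(4) by simp
qed

lemma subspace_dim_eq:
  assumes W: "subspace W" "W \<subseteq> V" and V: "V \<subseteq> span H" "finite H" and dim: "dim W = dim V"
  shows "V \<subseteq> W"
proof -
  obtain B where B: "B \<subseteq> W" "independent B" "W \<subseteq> span B" "card B = dim W" by (rule basis_exists)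
  obtain B' where B': "B \<subseteq> B'" "B' \<subseteq> V" "independent B'" "V \<subseteq> span B'"
    using maximal_independent_subset_extend[of B V] B W(2) by blast
  have "finite B'" using independent_span_bound[OF V(2) B'(3)] B'(2) V(1) by blast
  moreover have "card B' = card B" using basis_card_eq_dim[OF B'(2,4,3)] B(4) dim by simp
  ultimately have "B' = B" using B'(1) card_subset_eq by metis
  then show ?thesis using B'(4) span_minimal[OF B(1) W(1)] by blast
qed

end

lemma vector_space_poly: "vector_space (\<lambda>c p :: ('v, 'k::field) mpoly. single 0 c * p)"
  by unfold_locales (auto simp: algebra_simps single_add mult.assoc[symmetric] mult_single)

definition poly_dim :: "('v, 'k::field) mpoly set \<Rightarrow> nat" where
  "poly_dim = vector_space.dim (\<lambda>c p. single 0 c * p)"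

definition monom_basis :: "nat \<Rightarrow> ('v, 'k::field) mpoly set" where
  "monom_basis e = (\<lambda>t. single t 1) ` {t. mdeg t = e}"

lemma finite_monom_basis: "finite (monom_basis e :: ('v::finite, 'k::field) mpoly set)"
  by (simp add: monom_basis_def finite_monoms_mdeg_eq)

context
begin

interpretation poly: vector_space "\<lambda>c p :: ('v, 'k::field) mpoly. single 0 c * p"
  by (rule vector_space_poly)

lemma subspace_homogeneous: "poly.subspace (homogeneous e)"
  by (auto simp: poly.subspace_def intro: homogeneous_add)
     (use homogeneous_mult[OF homogeneous_single[of 0 0]] in force)

lemma subspace_ideal: "poly.subspace (ideal B)"
  by (auto simp: poly.subspace_def intro: ideal_add ideal_mult)

lemma homogeneous_subset_span: "(homogeneous e :: ('v, 'k::field) mpoly set) \<subseteq> poly.span (monom_basis e)"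
proof
  fix p :: "('v, 'k) mpoly" assume p: "p \<in> homogeneous e"
  have "single t (lookup p t) \<in> poly.span (monom_basis e)" if "t \<in> keys p" for t
  proof -
    have "single t 1 \<in> (monom_basis e :: ('v, 'k) mpoly set)"
      using homogeneousD[OF p that] by (auto simp: monom_basis_def)
    then have "single 0 (lookup p t) * single t 1 \<in> poly.span (monom_basis e)"
      by (intro poly.span_scale poly.span_base)
    then show ?thesis by (simp add: mult_single)
  qed
  then have "(\<Sum>t\<in>keys p. single t (lookup p t)) \<in> poly.span (monom_basis e)" by (rule poly.span_sum)
  then show "p \<in> poly.span (monom_basis e)" by (simp add: sum_single_keys)
qed

end

context
begin

interpretation poly: vector_space "\<lambda>c p :: ('v::finite, 'k::field) mpoly. single 0 c * p"
  by (rule vector_space_poly)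

lemma independent_monom_basis: "poly.independent (monom_basis e :: ('v::finite, 'k::field) mpoly set)"
proof (rule poly.independent_if_scalars_zero[OF finite_monom_basis])
  fix f :: "('v, 'k) mpoly \<Rightarrow> 'k" and x :: "('v, 'k) mpoly"
  assume z: "(\<Sum>x\<in>monom_basis e. single 0 (f x) * x) = 0" and x: "x \<in> monom_basis e"
  obtain s where s: "x = single s 1" "mdeg s = e" using x by (auto simp: monom_basis_def)
  have "lookup y s = (if y = x then 1 else 0)" if "y \<in> monom_basis e" for y
    using that by (auto simp: monom_basis_def s(1) lookup_single when_def)
  then have "(\<Sum>y\<in>monom_basis e. f y * lookup y s) = (\<Sum>y\<in>monom_basis e. if y = x then f x else 0)"
    by (intro sum.cong) auto
  also have "\<dots> = f x" using x by (simp add: finite_monom_basis)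
  finally have "(\<Sum>y\<in>monom_basis e. f y * lookup y s) = f x" .
  moreover have "(\<Sum>y\<in>monom_basis e. f y * lookup y s) = 0"
    using arg_cong[OF z, of "\<lambda>p. lookup p s"] by (simp add: lookup_sum poly_scale_lookup)
  ultimately show "f x = 0" by simp
qed

lemma poly_dim_zero: "poly_dim ({0} :: ('v::finite, 'k::field) mpoly set) = 0"
  unfolding poly_dim_def by (rule poly.dim_unique[of "{}"]) (auto simp: poly.independent_empty)

lemma poly_dim_homogeneous:
  "poly_dim (homogeneous e :: ('v::finite, 'k::field) mpoly set) = card {t :: 'v monom. mdeg t = e}"
proof -
  have "inj_on (\<lambda>t. single t (1::'k)) {t :: 'v monom. mdeg t = e}"
    by (rule inj_onI) (metis keys_single singleton_inject zero_neq_one)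
  then have "card (monom_basis e :: ('v, 'k) mpoly set) = card {t :: 'v monom. mdeg t = e}"
    by (simp add: monom_basis_def card_image)
  moreover have "monom_basis e \<subseteq> (homogeneous e :: ('v, 'k) mpoly set)"
    by (auto simp: monom_basis_def homogeneous_single)
  ultimately show ?thesis unfolding poly_dim_def
    using poly.dim_unique[OF _ homogeneous_subset_span independent_monom_basis] by blast
qed

text \<open>
  In a combination \<open>p + c * g\<close> that is homogeneous of degree \<open>e\<close>, the coefficient \<open>c\<close> may be replaced
  by its component of degree \<open>e - d\<close>, and the multiple of \<open>g\<close> drops out if \<open>e < d\<close>.
\<close>

lemma ideal_insert_homogeneous:
  fixes g :: "('v::finite, 'k::field) mpoly"
  assumes hB: "\<And>b. b \<in> B \<Longrightarrow> \<exists>d. b \<in> homogeneous d" and g: "g \<in> homogeneous d"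
  shows "ideal (insert g B) \<inter> homogeneous e =
    (if d \<le> e then {p + g * q |p q. p \<in> ideal B \<inter> homogeneous e \<and> q \<in> homogeneous (e - d)}
     else ideal B \<inter> homogeneous e)" (is "?l = ?r")
proof
  show "?l \<subseteq> ?r"
  proof
    fix u assume "u \<in> ?l"
    then obtain c where c: "u - c * g \<in> ideal B" and u: "u \<in> homogeneous e" by (auto simp: ideal_insert)
    have eq: "hom_component e (u - c * g) = u - hom_component e (g * c)"
      by (simp add: hom_component_diff hom_component_same[OF u] mult.commute)
    have hc: "hom_component e (u - c * g) \<in> ideal B \<inter> homogeneous e"
      using ideal_hom_component[of B, OF hB c] by simp
    show "u \<in> ?r"
    proof (cases "d \<le> e")
      case True
      then have "u = hom_component e (u - c * g) + g * hom_component (e - d) c"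
        by (simp add: eq hom_component_mult[OF g])
      then show ?thesis using True hc by (simp del: Int_iff) (metis hom_component_homogeneous)
    next
      case False
      then show ?thesis using hc eq by (simp add: hom_component_mult[OF g])
    qed
  qed
  have sub: "ideal B \<subseteq> ideal (insert g B)" by (rule ideal_mono) auto
  have "p + g * q \<in> ?l" if "d \<le> e" "p \<in> ideal B \<inter> homogeneous e" "q \<in> homogeneous (e - d)" for p q
  proof -
    have "g * q \<in> ideal (insert g B)" by (rule ideal_mult_right[OF ideal_base]) simp
    moreover have "g * q \<in> homogeneous e" using homogeneous_mult[OF g that(3)] that(1) by simp
    ultimately show ?thesis using that sub by (auto intro: ideal_add homogeneous_add)
  qed
  then show "?r \<subseteq> ?l" using sub by auto
qed

text \<open>
  The exact sequence of a regular element on graded pieces, written without subtraction.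
\<close>

lemma poly_dim_ideal_insert:
  fixes g :: "('v::finite, 'k::field) mpoly"
  assumes hB: "\<And>b. b \<in> B \<Longrightarrow> \<exists>d. b \<in> homogeneous d" and g: "g \<in> homogeneous d"
    and reg: "\<And>q. g * q \<in> ideal B \<Longrightarrow> q \<in> ideal B"
  shows "poly_dim (ideal (insert g B) \<inter> homogeneous e)
       + (if d \<le> e then poly_dim (ideal B \<inter> homogeneous (e - d)) else 0)
       = poly_dim (ideal B \<inter> homogeneous e)
       + (if d \<le> e then poly_dim (homogeneous (e - d) :: ('v, 'k) mpoly set) else 0)"
proof (cases "d \<le> e")
  case True
  have sub: "poly.subspace (ideal B \<inter> homogeneous j)" for j
    by (intro poly.subspace_inter subspace_ideal subspace_homogeneous)
  have "poly.dim {p + g * q |p q. p \<in> ideal B \<inter> homogeneous e \<and> q \<in> homogeneous (e - d)}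
      + poly.dim (ideal B \<inter> homogeneous (e - d))
    = poly.dim (ideal B \<inter> homogeneous e) + poly.dim (homogeneous (e - d) :: ('v, 'k) mpoly set)"
  proof (rule poly.dim_sum_image[of "(*) g"])
    show "ideal B \<inter> homogeneous e \<subseteq> poly.span (monom_basis e)"
         "homogeneous (e - d) \<subseteq> poly.span (monom_basis (e - d))"
      using homogeneous_subset_span by auto
    show "g * q \<in> ideal B \<inter> homogeneous e \<longleftrightarrow> q \<in> ideal B \<inter> homogeneous (e - d)" if "q \<in> homogeneous (e - d)" for q
      using that True homogeneous_mult[OF g that] reg by (auto intro: ideal_mult)
  qed (simp_all add: sub subspace_homogeneous finite_monom_basis distrib_left mult.left_commute)
  then show ?thesis using True ideal_insert_homogeneous[of B g d e, OF hB g] by (simp add: poly_dim_def)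
next
  case False
  then show ?thesis using ideal_insert_homogeneous[of B g d e, OF hB g] by simp
qed

lemma homogeneous_subset_ideal_if_poly_dim_eq:
  fixes B :: "('v::finite, 'k::field) mpoly set"
  assumes "poly_dim (ideal B \<inter> homogeneous e) = poly_dim (homogeneous e :: ('v, 'k) mpoly set)"
  shows "homogeneous e \<subseteq> ideal B"
proof -
  have "poly.subspace (ideal B \<inter> homogeneous e)"
    by (intro poly.subspace_inter subspace_ideal subspace_homogeneous)
  from poly.subspace_dim_eq[OF this _ homogeneous_subset_span finite_monom_basis] assms
  have "homogeneous e \<subseteq> ideal B \<inter> homogeneous e" by (simp add: poly_dim_def)
  then show ?thesis by blast
qed

end

section \<open>Hilbert series and the Macaulay bound\<close>

text \<open>
  A monomial in \<open>insert v V\<close> is either a monomial in \<open>V\<close> or a multiple of \<open>v\<close>, so each new variable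
  divides the series by \<open>1 - z\<close>.
\<close>

lemma monom_count_series:
  fixes V :: "'v::finite set"
  shows "Abs_fps (\<lambda>e. int (card {t :: 'v monom. keys t \<subseteq> V \<and> mdeg t = e})) * (1 - fps_X) ^ card V = 1"
proof -
  have "finite V" by simp
  then show ?thesis
  proof (induction V rule: finite_induct)
    case empty
    have "{t :: 'v monom. keys t \<subseteq> {} \<and> mdeg t = e} = (if e = 0 then {0} else {})" for e by auto
    then show ?case by (intro fps_ext) simp
  next
    case (insert v V)
    define S where "S W e = {t :: 'v monom. keys t \<subseteq> W \<and> mdeg t = e}" for W e
    define F where "F W = Abs_fps (\<lambda>e. int (card (S W e)))" for W
    have fin: "finite (S W e)" for W e
      by (rule finite_subset[OF _ finite_monoms_mdeg_eq[of e]]) (auto simp: S_def)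
    have card: "card (S (insert v V) (Suc e)) = card (S V (Suc e)) + card (S (insert v V) e)" for e
    proof -
      have "S (insert v V) (Suc e) = S V (Suc e) \<union> (\<lambda>s. s + single v 1) ` S (insert v V) e"
      proof (intro equalityI subsetI)
        fix t assume t: "t \<in> S (insert v V) (Suc e)"
        show "t \<in> S V (Suc e) \<union> (\<lambda>s. s + single v 1) ` S (insert v V) e"
        proof (cases "v \<in> keys t")
          case True
          then obtain s where s: "t = s + single v 1" by (rule monom_split_var)
          then have "keys s \<subseteq> keys t" by (auto simp: in_keys_iff lookup_add)
          then have "s \<in> S (insert v V) e" using t s by (auto simp: S_def)
          then show ?thesis using s by blast
        next
          case False
          then show ?thesis using t by (auto simp: S_def)
        qed
      next
        fix t assume "t \<in> S V (Suc e) \<union> (\<lambda>s. s + single v 1) ` S (insert v V) e"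
        then show "t \<in> S (insert v V) (Suc e)"
        proof
          assume "t \<in> (\<lambda>s. s + single v 1) ` S (insert v V) e"
          then obtain s where s: "s \<in> S (insert v V) e" "t = s + single v 1" by blast
          then have "keys t \<subseteq> insert v V" using keys_add[of s "single v 1"] by (auto simp: S_def)
          then show ?thesis using s by (simp add: S_def)
        qed (auto simp: S_def)
      qed
      moreover have "S V (Suc e) \<inter> (\<lambda>s. s + single v 1) ` S (insert v V) e = {}"
        using insert(2) by (auto simp: S_def subset_iff in_keys_iff lookup_add)
      moreover have "card ((\<lambda>s. s + single v 1) ` S (insert v V) e) = card (S (insert v V) e)"
        by (intro card_image inj_onI) simp
      ultimately show ?thesis using card_Un_disjoint[OF fin finite_imageI[OF fin]] by metis
    qed
    have "S (insert v V) 0 = {0}" "S V 0 = {0}" by (auto simp: S_def)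
    then have "F (insert v V) * (1 - fps_X) = F V"
      by (intro fps_ext) (auto simp: F_def right_diff_distrib card gr0_conv_Suc)
    then have "F (insert v V) * (1 - fps_X) ^ card (insert v V) = F V * (1 - fps_X) ^ card V"
      using insert by (simp add: mult.assoc[symmetric])
    then show ?case using insert by (simp add: F_def S_def)
  qed
qed

text \<open>
  Polynomial degrees, expressed for power series by the vanishing of the higher coefficients.
\<close>

lemma fps_prod_nth_eq_0:
  fixes F :: "'i \<Rightarrow> 'a::comm_ring_1 fps"
  assumes "finite A" "\<And>i j. i \<in> A \<Longrightarrow> j > c i \<Longrightarrow> fps_nth (F i) j = 0" "j > (\<Sum>i\<in>A. c i)"
  shows "fps_nth (\<Prod>i\<in>A. F i) j = 0"
  using assms
proof (induction A arbitrary: j rule: finite_induct)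
  case (insert x A)
  have "fps_nth (F x) k * fps_nth (\<Prod>i\<in>A. F i) (j - k) = 0" if "k \<le> j" for k
  proof (cases "k > c x")
    case True
    then show ?thesis using insert by simp
  next
    case False
    then have "j - k > (\<Sum>i\<in>A. c i)" using insert by simp
    then show ?thesis using insert by simp
  qed
  then show ?case using insert by (simp add: fps_mult_nth)
qed simp

text \<open>
  Macaulay's bound. \<open>M\<close> is the Hilbert series of the polynomial ring and \<open>L r\<close> that of the ideal of the
  first \<open>r\<close> elements. Each element multiplies the series \<open>M - L r\<close> of the quotient by \<open>1 - z\<^sup>d\<close>, and
  \<open>M = 1 / (1 - z)\<^sup>n\<close> cancels one factor \<open>1 - z\<close> of each of the \<open>n\<close> products. What remains is a
  polynomial of degree at most \<open>\<Sum> (d i - 1)\<close>.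
\<close>

theorem homogeneous_subset_regular_ideal:
  fixes a :: "nat \<Rightarrow> ('v::finite, 'k::field) mpoly"
  assumes hom: "\<And>i. i \<in> {1..CARD('v)} \<Longrightarrow> a i \<in> homogeneous (d i)"
    and reg: "\<And>i g. i \<in> {1..CARD('v)} \<Longrightarrow> a i * g \<in> ideal (a ` {1..<i}) \<Longrightarrow> g \<in> ideal (a ` {1..<i})"
    and e: "(\<Sum>i=1..CARD('v). d i - 1) < e"
  shows "homogeneous e \<subseteq> ideal (a ` {1..CARD('v)})"
proof -
  let ?n = "CARD('v)"
  define M where "M = Abs_fps (\<lambda>e. int (poly_dim (homogeneous e :: ('v, 'k) mpoly set)))"
  define L where "L r = Abs_fps (\<lambda>e. int (poly_dim (ideal (a ` {1..r}) \<inter> homogeneous e)))" for r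
  have M1: "M * (1 - fps_X) ^ ?n = 1"
    using monom_count_series[of "UNIV :: 'v set"] by (simp add: M_def poly_dim_homogeneous)
  have "M - L r = M * (\<Prod>i=1..r. 1 - fps_X ^ d i)" if "r \<le> ?n" for r
    using that
  proof (induction r)
    case 0
    have "{0} \<inter> homogeneous e = ({0} :: ('v, 'k) mpoly set)" for e by auto
    then have "L 0 = 0" by (intro fps_ext) (simp add: L_def poly_dim_zero)
    then show ?case by simp
  next
    case (Suc r)
    have set: "a ` {1..Suc r} = insert (a (Suc r)) (a ` {1..r})" by (simp add: atLeastAtMostSuc_conv)
    have lt: "{1..<Suc r} = {1..r}" by auto
    have step: "int (poly_dim (ideal (a ` {1..Suc r}) \<inter> homogeneous e))
        + (if d (Suc r) \<le> e then fps_nth (L r) (e - d (Suc r)) else 0)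
        = fps_nth (L r) e + (if d (Suc r) \<le> e then fps_nth M (e - d (Suc r)) else 0)" for e
    proof -
      have hB: "\<exists>d. b \<in> homogeneous d" if b: "b \<in> a ` {1..r}" for b
      proof -
        obtain i where "i \<in> {1..r}" "b = a i" using b by blast
        then show "\<exists>d. b \<in> homogeneous d" using hom[of i] Suc.prems by auto
      qed
      have g: "a (Suc r) \<in> homogeneous (d (Suc r))" using hom Suc.prems by simp
      have nzd: "q \<in> ideal (a ` {1..r})" if "a (Suc r) * q \<in> ideal (a ` {1..r})" for q
        using reg[of "Suc r" q] Suc.prems lt that by auto
      show ?thesis
        using poly_dim_ideal_insert[of "a ` {1..r}", OF hB g nzd, of e]
        unfolding set L_def M_def by (simp split: if_splits)
    qed
    have "M - L (Suc r) = (M - L r) * (1 - fps_X ^ d (Suc r))"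
    proof (intro fps_ext)
      fix e
      have "fps_nth (L (Suc r)) e = int (poly_dim (ideal (a ` {1..Suc r}) \<inter> homogeneous e))" by (simp add: L_def)
      then show "fps_nth (M - L (Suc r)) e = fps_nth ((M - L r) * (1 - fps_X ^ d (Suc r))) e"
        using step[of e] by (simp add: right_diff_distrib fps_X_power_mult_right_nth not_less[symmetric] split: if_splits)
    qed
    then show ?case using Suc by (simp add: mult.assoc)
  qed
  then have "M - L ?n = M * (\<Prod>i=1..?n. 1 - fps_X ^ d i)" by simp
  also have "(\<Prod>i=1..?n. 1 - fps_X ^ d i) = (1 - fps_X) ^ ?n * (\<Prod>i=1..?n. \<Sum>k<d i. fps_X ^ k :: int fps)"
    by (simp add: one_diff_power_eq prod.distrib)
  also have "M * \<dots> = (\<Prod>i=1..?n. \<Sum>k<d i. fps_X ^ k)" using M1 by (simp add: mult.assoc[symmetric])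
  finally have quotient_series: "M - L ?n = (\<Prod>i=1..?n. \<Sum>k<d i. fps_X ^ k)" .
  have "fps_nth (M - L ?n) e = 0"
    unfolding quotient_series using e by (intro fps_prod_nth_eq_0) (auto simp: fps_sum_nth fps_X_power_nth)
  then show ?thesis by (intro homogeneous_subset_ideal_if_poly_dim_eq) (simp add: M_def L_def)
qed

section \<open>Degree bounds for the reduced Groebner basis\<close>

context homogenized_monomial_order
begin

lemma max_GB_deg_le_if_y_injective:
  fixes B :: "('x option, 'k::field) mpoly set"
  assumes hB: "\<And>b. b \<in> B \<Longrightarrow> \<exists>d. b \<in> homogeneous d" and nz: "p \<in> B" "p \<noteq> 0"
    and fill: "homogeneous D \<subseteq> ideal (y_zero ` B)"
    and inj: "y_injective_from N (ideal B)" and DN: "D \<le> N"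
  shows "max_GB_deg (homogenized_ord ord) B \<le> N"
  by (rule max_GB_deg_le[OF _ nz]) (rule min_lead_monom_mdeg_le[OF hB fill inj DN])

lemma max_GB_deg_less_saturation:
  fixes B :: "('x option, 'k::field) mpoly set"
  assumes hB: "\<And>b. b \<in> B \<Longrightarrow> \<exists>d. b \<in> homogeneous d" and nz: "p \<in> B" "p \<noteq> 0"
    and fill: "homogeneous D \<subseteq> ideal (y_zero ` B)"
  shows "max_GB_deg (homogenized_ord ord) B < D + sat_index (ideal B) hom_var"
proof -
  let ?s = "sat_index (ideal B) hom_var"
  have s: "0 < ?s" "colon (ideal B) (hom_var ^ ?s) = saturation (ideal B) hom_var"
    using LeastI_ex[OF sat_index_exists[of B, OF hB fill]] by (simp_all add: sat_index_def)
  have "mdeg t < D + ?s" if "t \<in> min_lead_monoms (ideal B)" for t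
    using min_lead_monom_mdeg_saturation[of B, OF hB fill s that] by blast
  then have "max_GB_deg (homogenized_ord ord) B \<le> D + ?s - 1"
    using s(1) by (intro max_GB_deg_le[OF _ nz]) fastforce
  then show ?thesis using s(1) by simp
qed

end

text \<open>
  A finite bound excludes the value \<open>\<infinity>\<close>, so the least degree in the definition is attained.
\<close>

lemma d_reg_le_enatD:
  assumes "d_reg I \<le> enat E"
  obtains D where "d_reg I = enat D" "D \<le> E" "homogeneous D \<subseteq> I"
proof -
  have ex: "\<exists>d. I \<inter> homogeneous d = homogeneous d" using assms by (auto simp: d_reg_def split: if_splits)
  define D where "D = (LEAST d. I \<inter> homogeneous d = homogeneous d)"
  have "I \<inter> homogeneous D = homogeneous D" unfolding D_def by (rule LeastI_ex[OF ex])
  moreover have "d_reg I = enat D" using ex by (simp add: d_reg_def D_def)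
  ultimately show ?thesis using that assms by auto
qed

theorem theorem1:
  fixes f :: "nat \<Rightarrow> ('x::{finite,linorder}, 'k::field) mpoly"
    and d :: "nat \<Rightarrow> nat" and m n :: nat
  assumes n: "n = CARD('x)"
    and nonconst: "\<And>i. i \<in> {1..m} \<Longrightarrow> \<not> constant_poly (f i)"
    and d: "\<And>i. i \<in> {1..m} \<Longrightarrow> d i = tdeg (f i)"
  shows
    "(m > n \<and> 1 \<le> d (n + 1) \<and> mono_on {n + 1..m} d \<and>
        regular_sequence (\<lambda>i. top_part (f i)) n \<longrightarrow>
        int (max_GB_deg (homogenized_ord drl) (homogenization ` f ` {1..m}))
          \<le> (\<Sum>i=1..n. int (d i)) + int (d m) - int n \<and>
        (max (enat (d m)) (d_reg (ideal ((\<lambda>i. top_part (f i)) ` {1..n + 1})))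
            \<le> enat (nat (\<lfloor>((\<Sum>i=1..n + 1. real (d i)) - real n - 1) / 2\<rfloor> + 1)) \<longrightarrow>
          int (max_GB_deg (homogenized_ord drl) (homogenization ` f ` {1..m}))
            \<le> (\<Sum>i=1..n. int (d i)) + int (d (n + 1)) - int n))
     \<and>
     (let D = d_reg (ideal (top_part ` f ` {1..m}));
          s = sat_index (ideal (homogenization ` f ` {1..m})) hom_var
      in enat (max_GB_deg (homogenized_ord drl) (homogenization ` f ` {1..m})) \<le> D + enat s - 1)"
proof -
  interpret homogenized_monomial_order "drl :: 'x monom \<Rightarrow> 'x monom \<Rightarrow> bool"
    by (intro homogenized_monomial_order.intro graded_monomial_order_drl)
  define a where "a i = homogenization (f i)" for i
  have img: "homogenization ` f ` A = a ` A" for A by (auto simp: a_def)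
  have y_zero_a: "y_zero (a i) = top_part (f i)" for i by (simp add: a_def y_zero_homogenization)
  have y_zero_img: "y_zero ` a ` A = (\<lambda>i. top_part (f i)) ` A" for A by (simp add: y_zero_a image_image)
  have hom: "a i \<in> homogeneous (d i)" if "i \<in> {1..m}" for i
    using homogenization_homogeneous[of "f i"] d[OF that] by (simp add: a_def)
  have hB: "\<exists>d. b \<in> homogeneous d" if "b \<in> a ` A" for b A
    using that homogenization_homogeneous by (auto simp: a_def)
  have d1: "1 \<le> d i" if "i \<in> {1..m}" for i
    using nonconst[OF that] constant_poly_if_tdeg_0[of "f i"] d[OF that] by (cases "d i") auto
  have nz: "a i \<noteq> 0" if "i \<in> {1..m}" for i
  proof -
    have "f i \<noteq> 0" using nonconst[OF that] by (metis constant_poly_def Poly_Mapping.single_zero)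
    then show ?thesis by (simp add: a_def homogenization_nonzero)
  qed
  show ?thesis
  proof (intro conjI impI)
    assume asm: "m > n \<and> 1 \<le> d (n + 1) \<and> mono_on {n + 1..m} d \<and> regular_sequence (\<lambda>i. top_part (f i)) n"
    then have mn: "n < m" by simp
    have dm: "d j \<le> d m" if "j \<in> {n + 1..m}" for j
      using asm that mono_onD[of "{n + 1..m}" d j m] by auto
    define \<sigma> where "\<sigma> = (\<Sum>i=1..n. d i - 1)"
    have "int \<sigma> = (\<Sum>i=1..n. int (d i) - 1)"
      unfolding \<sigma>_def of_nat_sum by (rule sum.cong) (use d1 mn in \<open>auto simp: of_nat_diff\<close>)
    then have \<sigma>: "int \<sigma> = (\<Sum>i=1..n. int (d i)) - int n" by (simp add: sum_subtractf)
    have reg: "y_zero (a i) * g \<in> ideal (y_zero ` a ` {1..<i}) \<Longrightarrow> g \<in> ideal (y_zero ` a ` {1..<i})"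
      if "i \<in> {1..n}" for i g
      using asm that unfolding y_zero_img y_zero_a regular_sequence_def by blast
    have fill: "homogeneous (\<sigma> + 1) \<subseteq> ideal (y_zero ` a ` {1..n})"
      unfolding n image_image
      by (rule homogeneous_subset_regular_ideal[where d = d])
         (use reg hom mn in \<open>auto simp: n \<sigma>_def image_image intro!: y_zero_homogeneous\<close>)
    have fill_all: "homogeneous (\<sigma> + 1) \<subseteq> ideal (y_zero ` a ` {1..m})"
      using fill ideal_mono[of "y_zero ` a ` {1..n}" "y_zero ` a ` {1..m}"] mn by force
    have inj: "y_injective_from N (ideal (a ` {1..n}))" for N
      unfolding y_injective_from_def using y_nonzerodivisor_if_regular[of n a, OF reg] by blast
    \<comment> \<open>The homogenizations with indices \<open>r + 1, \<dots>, k\<close> are added to the first \<open>r\<close> ones.\<close>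
    have extend: "y_injective_from N (ideal (a ` {1..k}))"
      if "y_injective_from N (ideal (a ` {1..r}))" "homogeneous D \<subseteq> ideal (y_zero ` a ` {1..r})"
        "n \<le> r" "r \<le> k" "k \<le> m" "\<And>j. j \<in> {r + 1..k} \<Longrightarrow> D + d j \<le> N + 1" for N D r k
    proof -
      have "{1..k} = {1..r} \<union> {r + 1..k}" using that(4) by auto
      then have "a ` {1..k} = a ` {1..r} \<union> a ` {r + 1..k}" by (simp add: image_Un)
      moreover have "\<exists>d. c \<in> homogeneous d \<and> D + d \<le> N + 1" if c: "c \<in> a ` {r + 1..k}" for c
      proof -
        obtain j where "j \<in> {r + 1..k}" "c = a j" using c by blast
        then show ?thesis using hom[of j] \<open>k \<le> m\<close> \<open>\<And>j. j \<in> {r + 1..k} \<Longrightarrow> D + d j \<le> N + 1\<close> by auto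
      qed
      ultimately show ?thesis
        using y_injective_from_extend[where B = "a ` {1..r}" and C = "a ` {r + 1..k}" and N = N and D = D]
          hB[of _ "{1..r}"] that(1,2) by (metis (no_types, lifting))
    qed
    have bound: "max_GB_deg (homogenized_ord drl) (homogenization ` f ` {1..m}) \<le> N"
      if "y_injective_from N (ideal (a ` {1..m}))" "\<sigma> + 1 \<le> N" for N
      unfolding img using max_GB_deg_le_if_y_injective[of "a ` {1..m}" "a m" "\<sigma> + 1" N, OF hB] nz fill_all that mn by auto
    have "y_injective_from (\<sigma> + d m) (ideal (a ` {1..m}))"
      by (rule extend[OF inj fill]) (use mn dm in auto)
    from bound[OF this]
    show "int (max_GB_deg (homogenized_ord drl) (homogenization ` f ` {1..m}))
          \<le> (\<Sum>i=1..n. int (d i)) + int (d m) - int n"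
      using \<sigma> d1[of m] mn by simp
    define E where "E = nat (\<lfloor>((\<Sum>i=1..n + 1. real (d i)) - real n - 1) / 2\<rfloor> + 1)"
    assume "max (enat (d m)) (d_reg (ideal ((\<lambda>i. top_part (f i)) ` {1..n + 1})))
            \<le> enat (nat (\<lfloor>((\<Sum>i=1..n + 1. real (d i)) - real n - 1) / 2\<rfloor> + 1))"
    then have dmE: "d m \<le> E" and "d_reg (ideal (y_zero ` a ` {1..n + 1})) \<le> enat E"
      by (auto simp: E_def y_zero_img)
    then obtain D where D: "D \<le> E" "homogeneous D \<subseteq> ideal (y_zero ` a ` {1..n + 1})"
      by (auto elim: d_reg_le_enatD)
    have "real \<sigma> = (\<Sum>i=1..n. real (d i)) - real n"
      using arg_cong[OF \<sigma>, of real_of_int] by simp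
    then have "(\<Sum>i=1..n + 1. real (d i)) - real n - 1 = real \<sigma> + real (d (n + 1)) - 1" by simp
    then have E': "E = nat (\<lfloor>(real \<sigma> + real (d (n + 1)) - 1) / 2\<rfloor> + 1)" by (simp only: E_def)
    \<comment> \<open>The rounding is harmless: \<open>E\<close> is at most half of \<open>\<sigma> + d (n + 1) + 1\<close>.\<close>
    have two: "2 * E \<le> \<sigma> + d (n + 1) + 1"
    proof -
      let ?x = "(real \<sigma> + real (d (n + 1)) - 1) / 2"
      have "0 \<le> ?x" using asm by simp
      then have "real E = of_int \<lfloor>?x\<rfloor> + 1" unfolding E' by simp
      then have "real E \<le> ?x + 1" by linarith
      then show ?thesis by (simp add: field_simps)
    qed
    have "y_injective_from (\<sigma> + d (n + 1)) (ideal (a ` {1..n + 1}))"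
      by (rule extend[OF inj fill]) (use mn in auto)
    then have "y_injective_from (\<sigma> + d (n + 1)) (ideal (a ` {1..m}))"
    proof (rule extend[OF _ D(2)])
      fix j assume "j \<in> {n + 1 + 1..m}"
      then have "d j \<le> E" using dm[of j] dmE by simp
      then show "D + d j \<le> \<sigma> + d (n + 1) + 1" using D(1) two by simp
    qed (use mn in auto)
    from bound[OF this]
    show "int (max_GB_deg (homogenized_ord drl) (homogenization ` f ` {1..m}))
            \<le> (\<Sum>i=1..n. int (d i)) + int (d (n + 1)) - int n"
      using \<sigma> asm by simp
  next
    show "let D = d_reg (ideal (top_part ` f ` {1..m}));
          s = sat_index (ideal (homogenization ` f ` {1..m})) hom_var
      in enat (max_GB_deg (homogenized_ord drl) (homogenization ` f ` {1..m})) \<le> D + enat s - 1"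
    proof (cases "d_reg (ideal (top_part ` f ` {1..m}))")
      case infinity
      then show ?thesis by (simp add: Let_def one_enat_def)
    next
      case (enat D0)
      then have "d_reg (ideal (y_zero ` a ` {1..m})) \<le> enat D0" by (simp add: y_zero_a image_image)
      then obtain D where D: "d_reg (ideal (y_zero ` a ` {1..m})) = enat D" "homogeneous D \<subseteq> ideal (y_zero ` a ` {1..m})"
        by (rule d_reg_le_enatD)
      \<comment> \<open>Without polynomials the ideal is zero, and its degree of regularity is infinite.\<close>
      have "m \<noteq> 0"
      proof
        assume "m = 0"
        then have "(homogeneous D :: ('x, 'k) mpoly set) \<subseteq> {0}" using D(2) by simp
        moreover have "single (single undefined D) 1 \<in> (homogeneous D :: ('x, 'k) mpoly set)"
          by (simp add: homogeneous_single)
        ultimately have "single (single undefined D) 1 \<in> {0 :: ('x, 'k) mpoly}" by blast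
        then show False by (metis lookup_single_eq lookup_zero singletonD zero_neq_one)
      qed
      then have "max_GB_deg (homogenized_ord drl) (a ` {1..m}) < D + sat_index (ideal (a ` {1..m})) hom_var"
        using max_GB_deg_less_saturation[of "a ` {1..m}" "a 1" D, OF hB] nz D(2) by auto
      then show ?thesis
        using D(1) by (simp add: Let_def img y_zero_a a_def[symmetric] image_image one_enat_def)
    qed
  qed
qed

end
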